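(* Let $\mathcal A$ and $\mathcal B$ be locally small abelian categories with enough projectives, and let $F:\mathcal A\to\mathcal B$ and $G:\mathcal B\to\mathcal A$ be additive functors with $F$ left adjoint to $G$. Assume that $F$ and $G$ are exact and that $G$ preserves projective objects. Then for every integer $n\ge 1$ the functor $F$ preserves $n$-torsionfree objects, i.e. $X\in\mathcal T^n(\mathcal A)$ implies $F(X)\in\mathcal T^n(\mathcal B)$. If, moreover, $F$ is faithful and $\mathcal P(\mathcal A)=\mathrm{add}\,G(\mathcal P(\mathcal B))$, then for every $n\geq 1$ and every object $X$ of $\mathcal A$ one has $X\in\mathcal T^n(\mathcal A)$ if and only if $F(X)\in\mathcal T^n(\mathcal B)$.
   Context: For an abelian category $\mathcal A$ with enough projectives, $\mathcal P(\mathcal A)$ denotes the full subcategory of projective objects. A morphism $f:M\to P$ with $P\in\mathcal P(\mathcal A)$ is a left projective approximation if every morphism from $M$ to a projective object factors through $f$ (existence of such morphisms is not assumed). For $n\ge1$, an object $M$ is $n$-torsionfree if there is an exact sequence $0\to M\xrightarrow{f_1}P_1\xrightarrow{f_2}\cdots\xrightarrow{f_n}P_n$ with every $P_i$ projective such that the inclusion $\mathrm{Im} f_i\to P_i$ is a left projective approximation for $1\le i\le n$. The full subcategory of $n$-torsionfree objects is $\mathcal T^n(\mathcal A)$. For a class $\mathcal X$ of objects, $\mathrm{add}\,\mathcal X$ is its closure under finite direct sums and direct summands (subcategories are full and closed under isomorphisms); $G(\mathcal P(\mathcal B))$ is the class of objects $G(Q)$ with $Q\in\mathcal P(\mathcal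 B)$. *)

theory Defs
  imports "HOL-Algebra.Group"
begin

section \<open>Categories\<close>

text \<open>\<open>Cmp C g f\<close> is the composite "g after f"; it is unconstrained unless \<open>Cod C f = Dom C g\<close>.
  Local smallness needs no separate axiom: the morphisms between two objects always form a
  HOL set, so they can be the carrier of a group and the domain of a bijection.\<close>

record ('o, 'm) cat =
  Ob :: "'o set"
  Ar :: "'m set"
  Dom :: "'m \<Rightarrow> 'o"
  Cod :: "'m \<Rightarrow> 'o"
  Idt :: "'o \<Rightarrow> 'm"
  Cmp :: "'m \<Rightarrow> 'm \<Rightarrow> 'm"

definition homs :: "('o, 'm, 'z) cat_scheme \<Rightarrow> 'o \<Rightarrow> 'o \<Rightarrow> 'm set" where
  "homs C X Y = {f \<in> Ar C. Dom C f = X \<and> Cod C f = Y}"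

locale category =
  fixes C :: "('o, 'm, 'z) cat_scheme"
  assumes dom_in_Ob: "f \<in> Ar C \<Longrightarrow> Dom C f \<in> Ob C"
    and cod_in_Ob: "f \<in> Ar C \<Longrightarrow> Cod C f \<in> Ob C"
    and id_in_homs: "X \<in> Ob C \<Longrightarrow> Idt C X \<in> homs C X X"
    and cmp_in_homs: "f \<in> homs C X Y \<Longrightarrow> g \<in> homs C Y Z \<Longrightarrow> Cmp C g f \<in> homs C X Z"
    and id_left: "f \<in> homs C X Y \<Longrightarrow> Cmp C (Idt C Y) f = f"
    and id_right: "f \<in> homs C X Y \<Longrightarrow> Cmp C f (Idt C X) = f"
    and cmp_assoc: "f \<in> homs C W X \<Longrightarrow> g \<in> homs C X Y \<Longrightarrow> h \<in> homs C Y Z \<Longrightarrow>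
      Cmp C (Cmp C h g) f = Cmp C h (Cmp C g f)"

definition monic :: "('o, 'm, 'z) cat_scheme \<Rightarrow> 'm \<Rightarrow> bool" where
  "monic C f \<longleftrightarrow> f \<in> Ar C \<and>
    (\<forall>W. \<forall>g\<in>homs C W (Dom C f). \<forall>h\<in>homs C W (Dom C f). Cmp C f g = Cmp C f h \<longrightarrow> g = h)"

definition epic :: "('o, 'm, 'z) cat_scheme \<Rightarrow> 'm \<Rightarrow> bool" where
  "epic C f \<longleftrightarrow> f \<in> Ar C \<and>
    (\<forall>W. \<forall>g\<in>homs C (Cod C f) W. \<forall>h\<in>homs C (Cod C f) W. Cmp C g f = Cmp C h f \<longrightarrow> g = h)"

definition is_zero_object :: "('o, 'm, 'z) cat_scheme \<Rightarrow> 'o \<Rightarrow> bool" where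
  "is_zero_object C Z \<longleftrightarrow> Z \<in> Ob C \<and>
    (\<forall>X\<in>Ob C. (\<exists>!f. f \<in> homs C Z X) \<and> (\<exists>!f. f \<in> homs C X Z))"

section \<open>Abelian categories\<close>

text \<open>The additive structure of an abelian category is uniquely determined by the underlying
  category; carrying it in the record loses no generality.\<close>

record ('o, 'm) acat = "('o, 'm) cat" +
  Add :: "'m \<Rightarrow> 'm \<Rightarrow> 'm"
  Zero :: "'o \<Rightarrow> 'o \<Rightarrow> 'm"

definition hom_group :: "('o, 'm, 'z) acat_scheme \<Rightarrow> 'o \<Rightarrow> 'o \<Rightarrow> 'm monoid" where
  "hom_group C X Y = \<lparr>carrier = homs C X Y, mult = Add C, one = Zero C X Y\<rparr>"

locale preadditive_category = category C
  for C :: "('o, 'm, 'z) acat_scheme" +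
  assumes hom_comm_group: "X \<in> Ob C \<Longrightarrow> Y \<in> Ob C \<Longrightarrow> comm_group (hom_group C X Y)"
    and cmp_add_left: "f \<in> homs C X Y \<Longrightarrow> g \<in> homs C Y Z \<Longrightarrow> h \<in> homs C Y Z \<Longrightarrow>
      Cmp C (Add C g h) f = Add C (Cmp C g f) (Cmp C h f)"
    and cmp_add_right: "f \<in> homs C X Y \<Longrightarrow> g \<in> homs C X Y \<Longrightarrow> h \<in> homs C Y Z \<Longrightarrow>
      Cmp C h (Add C f g) = Add C (Cmp C h f) (Cmp C h g)"

definition is_kernel :: "('o, 'm, 'z) acat_scheme \<Rightarrow> 'm \<Rightarrow> 'm \<Rightarrow> bool" where
  "is_kernel C k f \<longleftrightarrow> k \<in> Ar C \<and> f \<in> Ar C \<and> Cod C k = Dom C f \<and>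
    Cmp C f k = Zero C (Dom C k) (Cod C f) \<and>
    (\<forall>W. \<forall>h\<in>homs C W (Dom C f). Cmp C f h = Zero C W (Cod C f) \<longrightarrow>
      (\<exists>!u. u \<in> homs C W (Dom C k) \<and> Cmp C k u = h))"

definition is_cokernel :: "('o, 'm, 'z) acat_scheme \<Rightarrow> 'm \<Rightarrow> 'm \<Rightarrow> bool" where
  "is_cokernel C c f \<longleftrightarrow> c \<in> Ar C \<and> f \<in> Ar C \<and> Dom C c = Cod C f \<and>
    Cmp C c f = Zero C (Dom C f) (Cod C c) \<and>
    (\<forall>W. \<forall>h\<in>homs C (Cod C f) W. Cmp C h f = Zero C (Dom C f) W \<longrightarrow>
      (\<exists>!u. u \<in> homs C (Cod C c) W \<and> Cmp C u c = h))"

definition is_biproduct ::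
  "('o, 'm, 'z) acat_scheme \<Rightarrow> 'o \<Rightarrow> 'o \<Rightarrow> 'o \<Rightarrow> 'm \<Rightarrow> 'm \<Rightarrow> 'm \<Rightarrow> 'm \<Rightarrow> bool" where
  "is_biproduct C X Y S i j p q \<longleftrightarrow> X \<in> Ob C \<and> Y \<in> Ob C \<and> S \<in> Ob C \<and>
    i \<in> homs C X S \<and> j \<in> homs C Y S \<and> p \<in> homs C S X \<and> q \<in> homs C S Y \<and>
    Cmp C p i = Idt C X \<and> Cmp C q j = Idt C Y \<and>
    Cmp C q i = Zero C X Y \<and> Cmp C p j = Zero C Y X \<and>
    Add C (Cmp C i p) (Cmp C j q) = Idt C S"

definition is_direct_sum :: "('o, 'm, 'z) acat_scheme \<Rightarrow> 'o \<Rightarrow> 'o \<Rightarrow> 'o \<Rightarrow> bool" where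
  "is_direct_sum C X Y S \<longleftrightarrow> (\<exists>i j p q. is_biproduct C X Y S i j p q)"

locale abelian_category = preadditive_category C
  for C :: "('o, 'm, 'z) acat_scheme" +
  assumes has_zero_object: "\<exists>Z. is_zero_object C Z"
    and has_direct_sums: "X \<in> Ob C \<Longrightarrow> Y \<in> Ob C \<Longrightarrow> \<exists>S. is_direct_sum C X Y S"
    and has_kernels: "f \<in> Ar C \<Longrightarrow> \<exists>k. is_kernel C k f"
    and has_cokernels: "f \<in> Ar C \<Longrightarrow> \<exists>c. is_cokernel C c f"
    and monic_is_kernel: "monic C f \<Longrightarrow> \<exists>g. is_kernel C f g"
    and epic_is_cokernel: "epic C f \<Longrightarrow> \<exists>g. is_cokernel C f g"

text \<open>\<open>is_image C m f\<close>: the morphism \<open>m\<close> is (a representative of) the inclusion of \<open>Im f\<close> into the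
  codomain of \<open>f\<close>, where \<open>Im f = Ker (Coker f)\<close>.\<close>

definition is_image :: "('o, 'm, 'z) acat_scheme \<Rightarrow> 'm \<Rightarrow> 'm \<Rightarrow> bool" where
  "is_image C m f \<longleftrightarrow> (\<exists>c. is_cokernel C c f \<and> is_kernel C m c)"

text \<open>\<open>Im f = Ker g\<close> as subobjects of \<open>Cod f = Dom g\<close>.\<close>

definition exact_at :: "('o, 'm, 'z) acat_scheme \<Rightarrow> 'm \<Rightarrow> 'm \<Rightarrow> bool" where
  "exact_at C f g \<longleftrightarrow> (\<exists>m. is_image C m f \<and> is_kernel C m g)"

definition short_exact :: "('o, 'm, 'z) acat_scheme \<Rightarrow> 'm \<Rightarrow> 'm \<Rightarrow> bool" where
  "short_exact C f g \<longleftrightarrow> (\<exists>Z. is_zero_object C Z \<and>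
    exact_at C (Zero C Z (Dom C f)) f \<and> exact_at C f g \<and> exact_at C g (Zero C (Cod C g) Z))"

section \<open>Projective objects, approximations, torsionfree objects\<close>

definition projectives :: "('o, 'm, 'z) cat_scheme \<Rightarrow> 'o set" where
  "projectives C = {P \<in> Ob C. \<forall>e. epic C e \<longrightarrow>
    (\<forall>f\<in>homs C P (Cod C e). \<exists>g\<in>homs C P (Dom C e). Cmp C e g = f)}"

definition enough_projectives :: "('o, 'm, 'z) cat_scheme \<Rightarrow> bool" where
  "enough_projectives C \<longleftrightarrow> (\<forall>X\<in>Ob C. \<exists>P\<in>projectives C. \<exists>e\<in>homs C P X. epic C e)"

definition left_projective_approximation :: "('o, 'm, 'z) cat_scheme \<Rightarrow> 'm \<Rightarrow> bool" where
  "left_projective_approximation C f \<longleftrightarrow> f \<in> Ar C \<and> Cod C f \<in> projectives C \<and>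
    (\<forall>Q\<in>projectives C. \<forall>h\<in>homs C (Dom C f) Q. \<exists>u\<in>homs C (Cod C f) Q. Cmp C u f = h)"

text \<open>Only meant for \<open>n \<ge> 1\<close>. The object \<open>M\<close> is the term \<open>P 0\<close> of the sequence.\<close>

definition torsionfree :: "('o, 'm, 'z) acat_scheme \<Rightarrow> nat \<Rightarrow> 'o set" where
  "torsionfree C n = {M \<in> Ob C. \<exists>P f Z. P 0 = M \<and> is_zero_object C Z \<and>
    (\<forall>i\<in>{1..n}. P i \<in> projectives C \<and> f i \<in> homs C (P (i - 1)) (P i)) \<and>
    exact_at C (Zero C Z M) (f 1) \<and>
    (\<forall>i\<in>{1..<n}. exact_at C (f i) (f (i + 1))) \<and>
    (\<forall>i\<in>{1..n}. \<exists>m. is_image C m (f i) \<and> left_projective_approximation C m)}"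

text \<open>Closure under isomorphism is included, since an object isomorphic to \<open>X\<close> is a direct sum of
  \<open>X\<close> and a zero object. The rule for zero objects is the empty direct sum.\<close>

inductive_set add_closure :: "('o, 'm, 'z) acat_scheme \<Rightarrow> 'o set \<Rightarrow> 'o set"
  for C :: "('o, 'm, 'z) acat_scheme" and S :: "'o set" where
  base: "X \<in> S \<Longrightarrow> X \<in> Ob C \<Longrightarrow> X \<in> add_closure C S"
| zero: "is_zero_object C Z \<Longrightarrow> Z \<in> add_closure C S"
| sum: "X \<in> add_closure C S \<Longrightarrow> Y \<in> add_closure C S \<Longrightarrow> is_direct_sum C X Y W \<Longrightarrow>
    W \<in> add_closure C S"
| summand: "W \<in> add_closure C S \<Longrightarrow> is_direct_sum C X Y W \<Longrightarrow> X \<in> add_closure C S"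

section \<open>Functors\<close>

record ('o1, 'm1, 'o2, 'm2) fctr =
  ObMap :: "'o1 \<Rightarrow> 'o2"
  ArMap :: "'m1 \<Rightarrow> 'm2"

definition is_functor ::
  "('o1, 'm1, 'y) cat_scheme \<Rightarrow> ('o2, 'm2, 'z) cat_scheme \<Rightarrow> ('o1, 'm1, 'o2, 'm2) fctr \<Rightarrow> bool" where
  "is_functor C D F \<longleftrightarrow>
    (\<forall>X\<in>Ob C. ObMap F X \<in> Ob D) \<and>
    (\<forall>X Y. \<forall>f\<in>homs C X Y. ArMap F f \<in> homs D (ObMap F X) (ObMap F Y)) \<and>
    (\<forall>X\<in>Ob C. ArMap F (Idt C X) = Idt D (ObMap F X)) \<and>
    (\<forall>X Y Z. \<forall>f\<in>homs C X Y. \<forall>g\<in>homs C Y Z.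
      ArMap F (Cmp C g f) = Cmp D (ArMap F g) (ArMap F f))"

definition additive_functor ::
  "('o1, 'm1, 'y) acat_scheme \<Rightarrow> ('o2, 'm2, 'z) acat_scheme \<Rightarrow> ('o1, 'm1, 'o2, 'm2) fctr \<Rightarrow> bool" where
  "additive_functor C D F \<longleftrightarrow> is_functor C D F \<and>
    (\<forall>X\<in>Ob C. \<forall>Y\<in>Ob C.
      ArMap F \<in> hom (hom_group C X Y) (hom_group D (ObMap F X) (ObMap F Y)))"

definition exact_functor ::
  "('o1, 'm1, 'y) acat_scheme \<Rightarrow> ('o2, 'm2, 'z) acat_scheme \<Rightarrow> ('o1, 'm1, 'o2, 'm2) fctr \<Rightarrow> bool" where
  "exact_functor C D F \<longleftrightarrow> additive_functor C D F \<and>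
    (\<forall>f g. short_exact C f g \<longrightarrow> short_exact D (ArMap F f) (ArMap F g))"

definition faithful_functor ::
  "('o1, 'm1, 'y) cat_scheme \<Rightarrow> ('o2, 'm2, 'z) cat_scheme \<Rightarrow> ('o1, 'm1, 'o2, 'm2) fctr \<Rightarrow> bool" where
  "faithful_functor C D F \<longleftrightarrow> is_functor C D F \<and>
    (\<forall>X\<in>Ob C. \<forall>Y\<in>Ob C. inj_on (ArMap F) (homs C X Y))"

definition preserves_projectives ::
  "('o1, 'm1, 'y) cat_scheme \<Rightarrow> ('o2, 'm2, 'z) cat_scheme \<Rightarrow> ('o1, 'm1, 'o2, 'm2) fctr \<Rightarrow> bool" where
  "preserves_projectives C D F \<longleftrightarrow> (\<forall>P\<in>projectives C. ObMap F P \<in> projectives D)"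

text \<open>\<open>left_adjoint C D F G\<close>: \<open>F\<close> from \<open>C\<close> to \<open>D\<close> is left adjoint to \<open>G\<close> from \<open>D\<close> to \<open>C\<close>, i.e. there are
  bijections between \<open>Hom (F X) Y\<close> and \<open>Hom X (G Y)\<close>, natural in both variables.\<close>

definition left_adjoint ::
  "('o1, 'm1, 'y) cat_scheme \<Rightarrow> ('o2, 'm2, 'z) cat_scheme \<Rightarrow>
    ('o1, 'm1, 'o2, 'm2) fctr \<Rightarrow> ('o2, 'm2, 'o1, 'm1) fctr \<Rightarrow> bool" where
  "left_adjoint C D F G \<longleftrightarrow> is_functor C D F \<and> is_functor D C G \<and>
    (\<exists>\<phi> :: 'o1 \<Rightarrow> 'o2 \<Rightarrow> 'm2 \<Rightarrow> 'm1.
      (\<forall>X\<in>Ob C. \<forall>Y\<in>Ob D.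
        bij_betw (\<phi> X Y) (homs D (ObMap F X) Y) (homs C X (ObMap G Y))) \<and>
      (\<forall>X\<in>Ob C. \<forall>X'\<in>Ob C. \<forall>Y\<in>Ob D. \<forall>Y'\<in>Ob D.
        \<forall>a\<in>homs C X' X. \<forall>b\<in>homs D Y Y'. \<forall>h\<in>homs D (ObMap F X) Y.
          \<phi> X' Y' (Cmp D b (Cmp D h (ArMap F a))) = Cmp C (ArMap G b) (Cmp C (\<phi> X Y h) a)))"

end

theory Submission
  imports Defs
begin

text \<open>An object is \<open>(n+1)\<close>-torsionfree iff it has a monic left projective approximation whose
  cokernel is \<open>n\<close>-torsionfree. Since \<open>G\<close> is exact and preserves projectives, \<open>F\<close> preserves
  projectives, monic approximations and their cokernels, hence \<open>n\<close>-torsionfree objects.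
  Conversely, the adjunct \<open>X \<rightarrow> G Q\<close> of a monic approximation \<open>F X \<rightarrow> Q\<close> is monic by faithfulness of
  \<open>F\<close>, and an approximation because every projective of \<open>A\<close> lies in \<open>add G(P(B))\<close>. Applying \<open>F\<close> to
  it gives a second monic approximation of \<open>F X\<close>; by Schanuel's lemma the two cokernels differ only
  by projective summands, which do not affect torsionfreeness, so induction applies.\<close>

section \<open>Computing in preadditive categories\<close>

text \<open>Approximations need not exist and are far from unique, so there is no cosyzygy functor
  that could be compared on both sides of \<open>F\<close>. For preservation this is harmless: an
  approximation chosen in \<open>A\<close> is pushed forward. Reflection is harder, because the
  sequence that makes \<open>F X\<close> torsionfree lives in \<open>B\<close> and its terms have no
  reason to come from \<open>A\<close>. Only its first map is transposed; everything beyond it is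
  recovered from the cokernel, and for this the property must not depend on the approximation
  chosen. The usual hypothesis of the dual Schanuel lemma, injectivity of the middle terms, is
  replaced by the fact that two approximations of one object factor through each other. The
  recursive description agrees with the one by sequences because exactness at P_i, for i < n,
  identifies the cokernel of f_i with the image of f_(i+1). The condition on image inclusions then
  says that this cokernel is embedded by an approximation.\<close>

context category
begin

abbreviation comp (infixr "\<cdot>" 75) where "g \<cdot> f \<equiv> Cmp C g f"

lemma homsD:
  assumes "f \<in> homs C X Y"
  shows "f \<in> Ar C" "Dom C f = X" "Cod C f = Y" "X \<in> Ob C" "Y \<in> Ob C"
  using assms dom_in_Ob cod_in_Ob by (auto simp: homs_def)

lemma Ar_homs: "f \<in> Ar C \<Longrightarrow> f \<in> homs C (Dom C f) (Cod C f)"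
  by (simp add: homs_def)

lemma Idt_simps [simp]:
  assumes "X \<in> Ob C"
  shows "Idt C X \<in> Ar C" "Dom C (Idt C X) = X" "Cod C (Idt C X) = X"
  using homsD[OF id_in_homs[OF assms]] by simp_all

lemma comp_simps [simp]:
  assumes "f \<in> Ar C" "g \<in> Ar C" "Cod C f = Dom C g"
  shows "g \<cdot> f \<in> Ar C" "Dom C (g \<cdot> f) = Dom C f" "Cod C (g \<cdot> f) = Cod C g"
  using homsD[OF cmp_in_homs[of f "Dom C f" "Cod C f" g "Cod C g"]] assms
  by (simp_all add: homs_def)

lemma comp_assoc [simp]:
  assumes "f \<in> Ar C" "g \<in> Ar C" "h \<in> Ar C" "Cod C f = Dom C g" "Cod C g = Dom C h"
  shows "(h \<cdot> g) \<cdot> f = h \<cdot> g \<cdot> f"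
  by (rule cmp_assoc[of f "Dom C f" "Cod C f" g "Cod C g" h "Cod C h"])
    (use assms in \<open>auto simp: homs_def\<close>)

lemma comp_Idt [simp]:
  assumes "f \<in> Ar C"
  shows "Cod C f = Y \<Longrightarrow> Idt C Y \<cdot> f = f" "Dom C f = X \<Longrightarrow> f \<cdot> Idt C X = f"
  using id_left[of f "Dom C f" "Cod C f"] id_right[of f "Dom C f" "Cod C f"] assms
  by (auto simp: homs_def)

text \<open>The simplifier nests composites to the right, so a known equation for
  \<open>g \<cdot> f\<close> no longer matches inside \<open>g \<cdot> f \<cdot> x\<close>. This
  form makes such equations usable there.\<close>

lemma comp_reassoc:
  assumes "g \<cdot> f = k" "f \<in> Ar C" "g \<in> Ar C" "x \<in> Ar C" "Cod C x = Dom C f" "Cod C f = Dom C g"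
  shows "g \<cdot> f \<cdot> x = k \<cdot> x"
  using assms comp_assoc[of x f g] by simp

lemma monic_cancel:
  assumes "monic C f" "f \<cdot> g = f \<cdot> h" "g \<in> Ar C" "h \<in> Ar C" "Cod C g = Dom C f"
    "Cod C h = Dom C f" "Dom C g = Dom C h"
  shows "g = h"
  using assms unfolding monic_def homs_def by blast

lemma epic_cancel:
  assumes "epic C f" "g \<cdot> f = h \<cdot> f" "g \<in> Ar C" "h \<in> Ar C" "Dom C g = Cod C f"
    "Dom C h = Cod C f" "Cod C g = Cod C h"
  shows "g = h"
  using assms unfolding epic_def homs_def by blast

lemma monic_comp:
  assumes "monic C f" "monic C g" "Cod C f = Dom C g"
  shows "monic C (g \<cdot> f)"
proof -
  have ar: "f \<in> Ar C" "g \<in> Ar C" using assms by (auto simp: monic_def)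
  have "a = b" if "a \<in> homs C W (Dom C f)" "b \<in> homs C W (Dom C f)" "(g \<cdot> f) \<cdot> a = (g \<cdot> f) \<cdot> b"
    for W a b
  proof -
    note ab = homsD[OF that(1)] homsD[OF that(2)]
    have "g \<cdot> f \<cdot> a = g \<cdot> f \<cdot> b" using that(3) ar ab assms(3) by simp
    then have "f \<cdot> a = f \<cdot> b"
      by (rule monic_cancel[OF assms(2)]) (use ar ab assms(3) in simp_all)
    then show ?thesis by (rule monic_cancel[OF assms(1)]) (use ar ab in simp_all)
  qed
  then show ?thesis using ar assms(3) by (auto simp: monic_def)
qed

lemma epic_comp:
  assumes "epic C f" "epic C g" "Cod C f = Dom C g"
  shows "epic C (g \<cdot> f)"
proof -
  have ar: "f \<in> Ar C" "g \<in> Ar C" using assms by (auto simp: epic_def)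
  have "a = b" if "a \<in> homs C (Cod C g) W" "b \<in> homs C (Cod C g) W" "a \<cdot> g \<cdot> f = b \<cdot> g \<cdot> f"
    for W a b
  proof -
    note ab = homsD[OF that(1)] homsD[OF that(2)]
    have "(a \<cdot> g) \<cdot> f = (b \<cdot> g) \<cdot> f" using that(3) ar ab assms(3) by simp
    then have "a \<cdot> g = b \<cdot> g"
      by (rule epic_cancel[OF assms(1)]) (use ar ab assms(3) in simp_all)
    then show ?thesis by (rule epic_cancel[OF assms(2)]) (use ar ab in simp_all)
  qed
  then show ?thesis using ar assms(3) by (auto simp: epic_def)
qed

lemma split_monic:
  assumes "f \<in> homs C X Y" "g \<in> homs C Y X" "g \<cdot> f = Idt C X"
  shows "monic C f"
proof -
  note fg = homsD[OF assms(1)] homsD[OF assms(2)]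
  have "a = b" if "a \<in> homs C W X" "b \<in> homs C W X" "f \<cdot> a = f \<cdot> b" for W a b
  proof -
    note ab = homsD[OF that(1)] homsD[OF that(2)]
    have "g \<cdot> f \<cdot> a = a" "g \<cdot> f \<cdot> b = b"
      using comp_reassoc[OF assms(3)] fg ab by simp_all
    then show ?thesis using that(3) by metis
  qed
  then show ?thesis using fg by (auto simp: monic_def)
qed

lemma epic_of_comp:
  assumes "epic C (g \<cdot> f)" "f \<in> Ar C" "g \<in> Ar C" "Cod C f = Dom C g"
  shows "epic C g"
proof -
  have "a = b" if "a \<in> homs C (Cod C g) W" "b \<in> homs C (Cod C g) W" "a \<cdot> g = b \<cdot> g" for W a b
  proof (rule epic_cancel[OF assms(1)])
    note ab = homsD[OF that(1)] homsD[OF that(2)]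
    show "a \<cdot> g \<cdot> f = b \<cdot> g \<cdot> f"
      using comp_assoc[of f g a] comp_assoc[of f g b] assms ab that(3) by simp
  qed (use homsD[OF that(1)] homsD[OF that(2)] assms in simp_all)
  then show ?thesis using assms by (auto simp: epic_def)
qed

lemma split_epic:
  assumes "f \<in> homs C X Y" "g \<in> homs C Y X" "g \<cdot> f = Idt C X"
  shows "epic C g"
proof (rule epic_of_comp)
  show "epic C (g \<cdot> f)"
    using homsD[OF assms(1)] unfolding assms(3) by (auto simp: epic_def homs_def)
qed (use homsD[OF assms(1)] homsD[OF assms(2)] in simp_all)

end

section \<open>Arithmetic of hom-groups\<close>

context preadditive_category
begin

abbreviation plus (infixl "\<oplus>" 65) where "f \<oplus> g \<equiv> Add C f g"

lemma Zero_simps [simp]: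
  assumes "X \<in> Ob C" "Y \<in> Ob C"
  shows "Zero C X Y \<in> Ar C" "Dom C (Zero C X Y) = X" "Cod C (Zero C X Y) = Y"
proof -
  interpret G: comm_group "hom_group C X Y" by (rule hom_comm_group[OF assms])
  have "Zero C X Y \<in> homs C X Y" using G.one_closed by (simp add: hom_group_def)
  then show "Zero C X Y \<in> Ar C" "Dom C (Zero C X Y) = X" "Cod C (Zero C X Y) = Y"
    by (auto simp: homs_def)
qed

context
  fixes f g h
  assumes f: "f \<in> Ar C" and g: "g \<in> Ar C" and h: "h \<in> Ar C"
    and D: "Dom C f = Dom C g" "Dom C h = Dom C g" and E: "Cod C f = Cod C g" "Cod C h = Cod C g"
begin

interpretation G: comm_group "hom_group C (Dom C g) (Cod C g)"
  using hom_comm_group dom_in_Ob cod_in_Ob g by blast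

text \<open>The group laws are imported from a single hom-group containing three parallel arrows;
  laws about fewer arrows are obtained afterwards by repeating an arrow.\<close>

lemma plus_simps_aux:
  "f \<oplus> g \<in> Ar C \<and> Dom C (f \<oplus> g) = Dom C f \<and> Cod C (f \<oplus> g) = Cod C f"
  using G.m_closed[of f g] f g D E by (simp add: hom_group_def homs_def)

lemma plus_cancel_aux: "f \<oplus> h = g \<oplus> h \<Longrightarrow> f = g"
  using G.right_cancel[of h f g] f g h D E by (simp add: hom_group_def homs_def)

lemma plus_zero_aux: "f \<oplus> Zero C (Dom C g) (Cod C g) = f \<and> Zero C (Dom C g) (Cod C g) \<oplus> f = f"
  using G.r_one[of f] G.l_one[of f] f D E by (simp add: hom_group_def homs_def)

lemma plus_comm_aux: "f \<oplus> g = g \<oplus> f"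
  using G.m_comm[of f g] f g D E by (simp add: hom_group_def homs_def)

lemma plus_assoc_aux: "f \<oplus> g \<oplus> h = f \<oplus> (g \<oplus> h)"
  using G.m_assoc[of f g h] f g h D E by (simp add: hom_group_def homs_def)

lemma plus_inverse_aux:
  "\<exists>g'\<in>homs C (Dom C g) (Cod C g). g \<oplus> g' = Zero C (Dom C g) (Cod C g)"
  using G.r_inv[of g] G.inv_closed[of g] g by (auto simp: hom_group_def homs_def)

end

lemma plus_simps [simp]:
  assumes "f \<in> Ar C" "g \<in> Ar C" "Dom C f = Dom C g" "Cod C f = Cod C g"
  shows "f \<oplus> g \<in> Ar C" "Dom C (f \<oplus> g) = Dom C g" "Cod C (f \<oplus> g) = Cod C g"
  using plus_simps_aux[of f g g] assms by auto

lemma plus_cancel: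
  assumes "f \<oplus> h = g \<oplus> h" "f \<in> homs C X Y" "g \<in> homs C X Y" "h \<in> homs C X Y"
  shows "f = g"
  using plus_cancel_aux[of f g h] assms by (simp add: homs_def)

lemma plus_Zero [simp]:
  assumes "f \<in> Ar C" "Dom C f = X" "Cod C f = Y"
  shows "f \<oplus> Zero C X Y = f" "Zero C X Y \<oplus> f = f"
  using plus_zero_aux[of f f f] assms by auto

lemma plus_comm:
  assumes "f \<in> Ar C" "g \<in> Ar C" "Dom C f = Dom C g" "Cod C f = Cod C g"
  shows "f \<oplus> g = g \<oplus> f"
  using plus_comm_aux[of f g f] assms by auto

lemma plus_assoc:
  assumes "f \<in> Ar C" "g \<in> Ar C" "h \<in> Ar C" "Dom C f = Dom C g" "Dom C g = Dom C h"
    "Cod C f = Cod C g" "Cod C g = Cod C h"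
  shows "f \<oplus> g \<oplus> h = f \<oplus> (g \<oplus> h)"
  by (rule plus_assoc_aux) (use assms in simp_all)

text \<open>The category record has addition and zero but no negation, so subtraction is always
  expressed by choosing an inverse with this rule.\<close>

lemma plus_inverse:
  assumes "f \<in> homs C X Y"
  obtains g where "g \<in> homs C X Y" "f \<oplus> g = Zero C X Y"
proof -
  have "\<exists>g\<in>homs C X Y. f \<oplus> g = Zero C X Y"
    using plus_inverse_aux[of f f f] homsD[OF assms] by simp
  then show thesis using that by blast
qed

lemma comp_plus [simp]:
  assumes "f \<in> Ar C" "g \<in> Ar C" "h \<in> Ar C" "Dom C f = Dom C g" "Cod C f = Cod C g"
  shows "Cod C h = Dom C g \<Longrightarrow> (f \<oplus> g) \<cdot> h = f \<cdot> h \<oplus> g \<cdot> h"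
    and "Dom C h = Cod C g \<Longrightarrow> h \<cdot> (f \<oplus> g) = h \<cdot> f \<oplus> h \<cdot> g"
  using assms cmp_add_left[of h "Dom C h" "Dom C f" f "Cod C f" g]
    cmp_add_right[of f "Dom C f" "Cod C f" g h "Cod C h"]
  by (auto simp: homs_def)

text \<open>By bilinearity a composite with a zero arrow equals its own double, and cancellation in
  the hom-group makes it zero.\<close>

lemma comp_Zero [simp]:
  assumes "f \<in> Ar C" "W \<in> Ob C"
  shows "Dom C f = X \<Longrightarrow> f \<cdot> Zero C W X = Zero C W (Cod C f)"
    and "Cod C f = X \<Longrightarrow> Zero C X W \<cdot> f = Zero C (Dom C f) W"
proof -
  have ob: "Dom C f \<in> Ob C" "Cod C f \<in> Ob C" using assms dom_in_Ob cod_in_Ob by auto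
  show "f \<cdot> Zero C W X = Zero C W (Cod C f)" if X: "Dom C f = X"
  proof (rule plus_cancel)
    have "f \<cdot> (Zero C W X \<oplus> Zero C W X) = f \<cdot> Zero C W X \<oplus> f \<cdot> Zero C W X"
      by (rule comp_plus) (use assms ob X in auto)
    then show "f \<cdot> Zero C W X \<oplus> f \<cdot> Zero C W X = Zero C W (Cod C f) \<oplus> f \<cdot> Zero C W X"
      using assms ob X by auto
  qed (use assms ob X in \<open>auto simp: homs_def\<close>)
  show "Zero C X W \<cdot> f = Zero C (Dom C f) W" if X: "Cod C f = X"
  proof (rule plus_cancel)
    have "(Zero C X W \<oplus> Zero C X W) \<cdot> f = Zero C X W \<cdot> f \<oplus> Zero C X W \<cdot> f"
      by (rule comp_plus) (use assms ob X in auto)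
    then show "Zero C X W \<cdot> f \<oplus> Zero C X W \<cdot> f = Zero C (Dom C f) W \<oplus> Zero C X W \<cdot> f"
      using assms ob X by auto
  qed (use assms ob X in \<open>auto simp: homs_def\<close>)
qed

text \<open>An arrow that identifies \<open>a\<close> and \<open>b\<close> kills their difference,
  formed here as \<open>a \<oplus> b'\<close> with \<open>b'\<close> the inverse of
  \<open>b\<close>. The criterion for epics is dual.\<close>

lemma monicI:
  assumes f: "f \<in> homs C X Y"
    and z: "\<And>W g. f \<cdot> g = Zero C W Y \<Longrightarrow> g \<in> homs C W X \<Longrightarrow> g = Zero C W X"
  shows "monic C f"
proof -
  note f' = homsD[OF f]
  have "a = b" if a: "a \<in> homs C W X" and b: "b \<in> homs C W X" and eq: "f \<cdot> a = f \<cdot> b" for W a b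
  proof -
    obtain b' where b': "b' \<in> homs C W X" "b \<oplus> b' = Zero C W X" using plus_inverse[OF b] .
    note ab = homsD[OF a] homsD[OF b] homsD[OF b'(1)]
    have "f \<cdot> (a \<oplus> b') = f \<cdot> (b \<oplus> b')" using f' ab eq by simp
    also have "\<dots> = Zero C W Y" using f' ab unfolding b'(2) by simp
    finally have "f \<cdot> (a \<oplus> b') = Zero C W Y" .
    then have "a \<oplus> b' = Zero C W X" by (rule z) (use ab in \<open>simp_all add: homs_def\<close>)
    then show ?thesis using plus_cancel[OF _ a b b'(1)] b'(2) by simp
  qed
  then show ?thesis using f' by (auto simp: monic_def)
qed

lemma epicI:
  assumes f: "f \<in> homs C X Y"
    and z: "\<And>W g. g \<cdot> f = Zero C X W \<Longrightarrow> g \<in> homs C Y W \<Longrightarrow> g = Zero C Y W"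
  shows "epic C f"
proof -
  note f' = homsD[OF f]
  have "a = b" if a: "a \<in> homs C Y W" and b: "b \<in> homs C Y W" and eq: "a \<cdot> f = b \<cdot> f" for W a b
  proof -
    obtain b' where b': "b' \<in> homs C Y W" "b \<oplus> b' = Zero C Y W" using plus_inverse[OF b] .
    note ab = homsD[OF a] homsD[OF b] homsD[OF b'(1)]
    have "(a \<oplus> b') \<cdot> f = (b \<oplus> b') \<cdot> f" using f' ab eq by simp
    also have "\<dots> = Zero C X W" using f' ab unfolding b'(2) by simp
    finally have "(a \<oplus> b') \<cdot> f = Zero C X W" .
    then have "a \<oplus> b' = Zero C Y W" by (rule z) (use ab in \<open>simp_all add: homs_def\<close>)
    then show ?thesis using plus_cancel[OF _ a b b'(1)] b'(2) by simp
  qed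
  then show ?thesis using f' by (auto simp: epic_def)
qed

section \<open>Kernels and cokernels\<close>

lemma kernelD:
  assumes "is_kernel C k f"
  shows "k \<in> Ar C" "f \<in> Ar C" "Cod C k = Dom C f" "f \<cdot> k = Zero C (Dom C k) (Cod C f)"
    "Dom C k \<in> Ob C" "Dom C f \<in> Ob C" "Cod C f \<in> Ob C"
  using assms dom_in_Ob cod_in_Ob by (auto simp: is_kernel_def)

lemma cokernelD:
  assumes "is_cokernel C c f"
  shows "c \<in> Ar C" "f \<in> Ar C" "Dom C c = Cod C f" "c \<cdot> f = Zero C (Dom C f) (Cod C c)"
    "Dom C f \<in> Ob C" "Cod C f \<in> Ob C" "Cod C c \<in> Ob C"
  using assms dom_in_Ob cod_in_Ob by (auto simp: is_cokernel_def)

lemma kernel_factor: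
  assumes "is_kernel C k f" "h \<in> homs C W (Dom C f)" "f \<cdot> h = Zero C W (Cod C f)"
  obtains u where "u \<in> homs C W (Dom C k)" "k \<cdot> u = h"
  using assms unfolding is_kernel_def by blast

lemma cokernel_factor:
  assumes "is_cokernel C c f" "h \<in> homs C (Cod C f) W" "h \<cdot> f = Zero C (Dom C f) W"
  obtains u where "u \<in> homs C (Cod C c) W" "u \<cdot> c = h"
  using assms unfolding is_cokernel_def by blast

lemma kernel_monic:
  assumes "is_kernel C k f"
  shows "monic C k"
proof -
  note k = kernelD[OF assms]
  have "a = b" if "a \<in> homs C W (Dom C k)" "b \<in> homs C W (Dom C k)" "k \<cdot> a = k \<cdot> b" for W a b
  proof -
    note ab = homsD[OF that(1)] homsD[OF that(2)]
    have "f \<cdot> k \<cdot> a = Zero C W (Cod C f)" using comp_reassoc[OF k(4)] k ab by simp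
    moreover have "k \<cdot> a \<in> homs C W (Dom C f)" using k ab by (simp add: homs_def)
    ultimately have "\<exists>!u. u \<in> homs C W (Dom C k) \<and> k \<cdot> u = k \<cdot> a"
      using assms unfolding is_kernel_def by blast
    then show ?thesis using that by metis
  qed
  then show ?thesis using k by (auto simp: monic_def)
qed

lemma cokernel_epic:
  assumes "is_cokernel C c f"
  shows "epic C c"
proof -
  note c = cokernelD[OF assms]
  have "a = b" if "a \<in> homs C (Cod C c) W" "b \<in> homs C (Cod C c) W" "a \<cdot> c = b \<cdot> c" for W a b
  proof -
    note ab = homsD[OF that(1)] homsD[OF that(2)]
    have "(a \<cdot> c) \<cdot> f = Zero C (Dom C f) W" using c ab by simp
    moreover have "a \<cdot> c \<in> homs C (Cod C f) W" using c ab by (simp add: homs_def)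
    ultimately have "\<exists>!u. u \<in> homs C (Cod C c) W \<and> u \<cdot> c = a \<cdot> c"
      using assms unfolding is_cokernel_def by blast
    then show ?thesis using that by metis
  qed
  then show ?thesis using c by (auto simp: epic_def)
qed

text \<open>Monicity already gives the uniqueness half of the universal property, so only the
  existence of factorizations has to be checked.\<close>

lemma is_kernelI:
  assumes "monic C k" "f \<in> Ar C" "Cod C k = Dom C f" "f \<cdot> k = Zero C (Dom C k) (Cod C f)"
    and fac: "\<And>W h. h \<in> homs C W (Dom C f) \<Longrightarrow> f \<cdot> h = Zero C W (Cod C f) \<Longrightarrow>
      \<exists>u\<in>homs C W (Dom C k). k \<cdot> u = h"
  shows "is_kernel C k f"
proof -
  have "k \<in> Ar C" using assms(1) by (simp add: monic_def)
  then show ?thesis unfolding is_kernel_def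
    using assms fac by (metis monic_def)
qed

lemma is_cokernelI:
  assumes "epic C c" "f \<in> Ar C" "Dom C c = Cod C f" "c \<cdot> f = Zero C (Dom C f) (Cod C c)"
    and fac: "\<And>W h. h \<in> homs C (Cod C f) W \<Longrightarrow> h \<cdot> f = Zero C (Dom C f) W \<Longrightarrow>
      \<exists>u\<in>homs C (Cod C c) W. u \<cdot> c = h"
  shows "is_cokernel C c f"
proof -
  have "c \<in> Ar C" using assms(1) by (simp add: epic_def)
  then show ?thesis unfolding is_cokernel_def
    using assms fac by (metis epic_def)
qed

text \<open>An epic in front of \<open>f\<close> does not change which arrows kill \<open>f\<close>,
  and a cokernel depends on nothing else. Images inherit this invariance, which lets
  \<open>f\<close> be exchanged for its factor behind an epic.\<close>

lemma cokernel_comp_epic: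
  assumes e: "epic C e" "Cod C e = Dom C f" and f: "f \<in> Ar C"
  shows "is_cokernel C c (f \<cdot> e) \<longleftrightarrow> is_cokernel C c f"
proof -
  have ar: "e \<in> Ar C" "Dom C e \<in> Ob C" "Dom C f \<in> Ob C"
    using e f dom_in_Ob by (auto simp: epic_def)
  have eq: "h \<cdot> f \<cdot> e = Zero C (Dom C e) W \<longleftrightarrow> h \<cdot> f = Zero C (Dom C f) W"
    if "h \<in> Ar C" "Dom C h = Cod C f" "Cod C h = W" for h W
  proof
    have W: "W \<in> Ob C" using that cod_in_Ob by auto
    show "h \<cdot> f = Zero C (Dom C f) W" if "h \<cdot> f \<cdot> e = Zero C (Dom C e) W"
      by (rule epic_cancel[OF e(1)])
        (use \<open>h \<in> Ar C\<close> \<open>Dom C h = Cod C f\<close> \<open>Cod C h = W\<close> that ar e f W in simp_all)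
    show "h \<cdot> f \<cdot> e = Zero C (Dom C e) W" if "h \<cdot> f = Zero C (Dom C f) W"
      using comp_reassoc[OF that, of e] \<open>h \<in> Ar C\<close> \<open>Dom C h = Cod C f\<close> ar e f W by simp
  qed
  show ?thesis
    unfolding is_cokernel_def using eq e f ar by (auto simp: homs_def)
qed

text \<open>The section of \<open>e\<close> is induced by \<open>1 - jw\<close>, which kills \<open>j\<close>.\<close>

lemma split_direct_sum:
  assumes j: "j \<in> homs C P E" and w: "w \<in> homs C E P" and wj: "w \<cdot> j = Idt C P"
    and e: "is_cokernel C e j"
  shows "is_direct_sum C (Cod C e) P E"
proof -
  note j' = homsD[OF j] and w' = homsD[OF w] and e' = cokernelD[OF e]
  have jw: "j \<cdot> w \<in> homs C E E" using j' w' by (simp add: homs_def)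
  obtain n where n: "n \<in> homs C E E" "j \<cdot> w \<oplus> n = Zero C E E" using plus_inverse[OF jw] .
  note n' = homsD[OF n(1)]
  define t where "t = Idt C E \<oplus> n"
  have t: "t \<in> Ar C" "Dom C t = E" "Cod C t = E" using n' by (auto simp: t_def)
  have jwj: "j \<cdot> w \<cdot> j = j" using wj j' w' by simp
  have nj: "j \<oplus> n \<cdot> j = Zero C P E"
  proof -
    have "(j \<cdot> w \<oplus> n) \<cdot> j = Zero C P E" using n(2) j' by simp
    then show ?thesis using j' w' n' jwj by simp
  qed
  then have tj: "t \<cdot> j = Zero C P E" using n' j' by (simp add: t_def)
  obtain s where s: "s \<in> homs C (Cod C e) E" "s \<cdot> e = t"
    by (rule cokernel_factor[OF e, of t E]) (use t tj j' in \<open>auto simp: homs_def\<close>)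
  note s' = homsD[OF s(1)]
  \<comment> \<open>Here \<open>n\<close> is the negative of \<open>j \<cdot> w\<close>, so
    \<open>s \<cdot> e = t\<close> is \<open>1 - jw\<close>; adding \<open>n\<close> to both sides
    avoids any explicit subtraction.\<close>
  have sum: "s \<cdot> e \<oplus> j \<cdot> w = Idt C E"
  proof (rule plus_cancel)
    have "(Idt C E \<oplus> n \<oplus> j \<cdot> w) \<oplus> n = Idt C E \<oplus> (j \<cdot> w \<oplus> n) \<oplus> n"
      using plus_assoc[of "Idt C E" n "j \<cdot> w"] plus_comm[of n "j \<cdot> w"] n' j' w' by simp
    then show "(s \<cdot> e \<oplus> j \<cdot> w) \<oplus> n = Idt C E \<oplus> n" using n' n(2) s(2) by (simp add: t_def)
  qed (use j' w' e' s' n' in \<open>auto simp: homs_def\<close>)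
  have se: "s \<cdot> e \<cdot> x \<oplus> j \<cdot> w \<cdot> x = x" if "x \<in> Ar C" "Cod C x = E" for x
  proof -
    have "(s \<cdot> e \<oplus> j \<cdot> w) \<cdot> x = x" using sum that by simp
    then show ?thesis using that j' w' e' s' by simp
  qed
  have es: "e \<cdot> s = Idt C (Cod C e)"
  proof (rule epic_cancel[OF cokernel_epic[OF e]])
    have "e \<cdot> (s \<cdot> e \<oplus> j \<cdot> w) = e" using sum e' j' by simp
    moreover have "e \<cdot> j \<cdot> w = Zero C E (Cod C e)" using comp_reassoc[OF e'(4)] e' w' j' by simp
    ultimately show "(e \<cdot> s) \<cdot> e = Idt C (Cod C e) \<cdot> e" using e' s' j' w' by simp
  qed (use e' s' j' in simp_all)
  have ws: "w \<cdot> s = Zero C (Cod C e) P"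
  proof (rule epic_cancel[OF cokernel_epic[OF e]])
    have "w \<cdot> (s \<cdot> e \<oplus> j \<cdot> w) = w" using sum w' by simp
    moreover have "w \<cdot> j \<cdot> w = w" using comp_reassoc[OF wj] w' j' by simp
    ultimately have *: "w \<cdot> s \<cdot> e \<oplus> w = w" using w' s' e' j' by simp
    have "w \<cdot> s \<cdot> e = Zero C E P"
      by (rule plus_cancel[of _ w _ E P]) (use * w' s' e' j' in \<open>auto simp: homs_def\<close>)
    then show "(w \<cdot> s) \<cdot> e = Zero C (Cod C e) P \<cdot> e" using e' s' j' w' by simp
  qed (use e' s' j' w' in simp_all)
  have "e \<in> homs C E (Cod C e)" "e \<cdot> j = Zero C P (Cod C e)" using e' j' by (simp_all add: homs_def)
  then have "is_biproduct C (Cod C e) P E s j e w"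
    unfolding is_biproduct_def using s(1) j w e'(7) j'(4,5) es wj ws sum by blast
  then show ?thesis unfolding is_direct_sum_def by blast
qed

lemma biproductD:
  assumes "is_biproduct C X Y S i j p q"
  shows "i \<in> homs C X S" "j \<in> homs C Y S" "p \<in> homs C S X" "q \<in> homs C S Y"
    "p \<cdot> i = Idt C X" "q \<cdot> j = Idt C Y" "q \<cdot> i = Zero C X Y" "p \<cdot> j = Zero C Y X"
    "i \<cdot> p \<oplus> j \<cdot> q = Idt C S"
  using assms unfolding is_biproduct_def by blast+

lemma biproduct_sym:
  assumes "is_biproduct C X Y S i j p q"
  shows "is_biproduct C Y X S j i q p"
proof -
  note b = biproductD[OF assms]
  note ar = b(1-4)[THEN homsD(1)] b(1-4)[THEN homsD(2)] b(1-4)[THEN homsD(3)]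
  have "j \<cdot> q \<oplus> i \<cdot> p = Idt C S" using b(9) plus_comm[of "j \<cdot> q" "i \<cdot> p"] ar by simp
  then show ?thesis using assms unfolding is_biproduct_def by blast
qed

lemma biproduct_decompose:
  assumes "is_biproduct C X Y S i j p q"
  shows "t \<in> homs C S W \<Longrightarrow> (t \<cdot> i) \<cdot> p \<oplus> (t \<cdot> j) \<cdot> q = t"
    and "s \<in> homs C W S \<Longrightarrow> i \<cdot> p \<cdot> s \<oplus> j \<cdot> q \<cdot> s = s"
proof -
  note b = biproductD[OF assms]
  note ar = b(1-4)[THEN homsD(1)] b(1-4)[THEN homsD(2)] b(1-4)[THEN homsD(3)]
  show "(t \<cdot> i) \<cdot> p \<oplus> (t \<cdot> j) \<cdot> q = t" if "t \<in> homs C S W"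
  proof -
    note t = homsD[OF that]
    have "t \<cdot> (i \<cdot> p \<oplus> j \<cdot> q) = t" using b(9) t by simp
    then show ?thesis using t ar by simp
  qed
  show "i \<cdot> p \<cdot> s \<oplus> j \<cdot> q \<cdot> s = s" if "s \<in> homs C W S"
  proof -
    note s = homsD[OF that]
    have "(i \<cdot> p \<oplus> j \<cdot> q) \<cdot> s = s" using b(9) s by simp
    then show ?thesis using s ar by simp
  qed
qed

end

section \<open>Zero objects and exactness at the ends of a sequence\<close>

context preadditive_category
begin

lemma monic_Idt: "X \<in> Ob C \<Longrightarrow> monic C (Idt C X)"
  by (rule split_monic[of _ X X "Idt C X"]) (simp_all add: homs_def)

lemma epic_Idt: "X \<in> Ob C \<Longrightarrow> epic C (Idt C X)"
  by (rule split_epic[of "Idt C X" X X]) (simp_all add: homs_def)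

lemma zero_object_unique:
  assumes "is_zero_object C Z"
  shows "f \<in> homs C Z X \<Longrightarrow> f = Zero C Z X" "g \<in> homs C X Z \<Longrightarrow> g = Zero C X Z"
proof -
  have Z: "Z \<in> Ob C" using assms by (simp add: is_zero_object_def)
  show "f = Zero C Z X" if f: "f \<in> homs C Z X"
  proof -
    have X: "X \<in> Ob C" using homsD[OF f] by blast
    then have "Zero C Z X \<in> homs C Z X" using Z by (simp add: homs_def)
    then show ?thesis using assms X f unfolding is_zero_object_def by blast
  qed
  show "g = Zero C X Z" if g: "g \<in> homs C X Z"
  proof -
    have X: "X \<in> Ob C" using homsD[OF g] by blast
    then have "Zero C X Z \<in> homs C X Z" using Z by (simp add: homs_def)
    then show ?thesis using assms X g unfolding is_zero_object_def by blast
  qed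
qed

text \<open>The identity kills the zero arrow and hence factors through its cokernel
  \<open>c\<close>. So \<open>c\<close> has a left inverse, and its kernel \<open>m\<close>, which
  is also the kernel of \<open>f\<close>, vanishes.\<close>

lemma exact_at_Zero_left_iff:
  assumes Z: "is_zero_object C Z" and f: "f \<in> homs C X Y"
  shows "exact_at C (Zero C Z X) f \<longleftrightarrow> monic C f"
proof
  note f' = homsD[OF f]
  have Zo: "Z \<in> Ob C" using Z by (simp add: is_zero_object_def)
  show "monic C f" if ex: "exact_at C (Zero C Z X) f"
  proof (rule monicI[OF f])
    obtain m c where c: "is_cokernel C c (Zero C Z X)" and mc: "is_kernel C m c"
      and m: "is_kernel C m f"
      using ex unfolding exact_at_def is_image_def by blast
    note c' = cokernelD[OF c] and m' = kernelD[OF m]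
    obtain u where u: "u \<in> homs C (Cod C c) X" "u \<cdot> c = Idt C X"
      by (rule cokernel_factor[OF c, of "Idt C X" X]) (use f' Zo in \<open>simp_all add: homs_def\<close>)
    have "u \<cdot> c \<cdot> m = Zero C (Dom C m) X"
      using homsD[OF u(1)] kernelD(4)[OF mc] m' by simp
    then have m0: "m = Zero C (Dom C m) X"
      using comp_reassoc[OF u(2), of m] homsD[OF u(1)] c' m' f' Zo by simp
    fix W g assume "f \<cdot> g = Zero C W Y" "g \<in> homs C W X"
    then obtain v where v: "v \<in> homs C W (Dom C m)" "m \<cdot> v = g"
      using kernel_factor[OF m] f' by metis
    have "Zero C (Dom C m) X \<cdot> v = Zero C W X" using homsD[OF v(1)] f' by simp
    then show "g = Zero C W X" using v(2) m0 by simp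
  qed
  show "exact_at C (Zero C Z X) f" if mono: "monic C f"
  proof -
    have zero_monic: "monic C (Zero C Z X)"
      by (rule monicI[of _ Z X]) (use zero_object_unique[OF Z] f' Zo in \<open>simp_all add: homs_def\<close>)
    \<comment> \<open>Applied twice below: to the identity, where it computes the image of the zero
      arrow, and to \<open>f\<close> itself.\<close>
    have ker: "is_kernel C (Zero C Z X) h" if h: "h \<in> homs C X V" "monic C h" for h V
    proof (rule is_kernelI[OF zero_monic])
      note h' = homsD[OF h(1)]
      fix W g assume g: "g \<in> homs C W (Dom C h)" "h \<cdot> g = Zero C W (Cod C h)"
      note g' = homsD[OF g(1)]
      have "g = Zero C W X"
        by (rule monic_cancel[OF h(2)]) (use g(2) g' h' in simp_all)
      then show "\<exists>u\<in>homs C W (Dom C (Zero C Z X)). Zero C Z X \<cdot> u = g"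
        using g' f' Zo by (intro bexI[of _ "Zero C W Z"]) (simp_all add: homs_def)
    qed (use homsD[OF h(1)] Zo in simp_all)
    have "is_cokernel C (Idt C X) (Zero C Z X)"
      by (rule is_cokernelI) (use f' Zo epic_Idt in \<open>simp_all add: homs_def\<close>)
    moreover have "is_kernel C (Zero C Z X) (Idt C X)"
      by (rule ker) (use f' monic_Idt in \<open>simp_all add: homs_def\<close>)
    ultimately show ?thesis
      using ker[OF f mono] unfolding exact_at_def is_image_def by blast
  qed
qed

text \<open>Dually, the kernel \<open>m\<close> of a zero arrow has a right inverse, so a cokernel
  of \<open>g\<close> that kills \<open>m\<close> is zero.\<close>

lemma exact_at_Zero_right_iff:
  assumes Z: "is_zero_object C Z" and g: "g \<in> homs C X Y"
  shows "exact_at C g (Zero C Y Z) \<longleftrightarrow> epic C g"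
proof
  note g' = homsD[OF g]
  have Zo: "Z \<in> Ob C" using Z by (simp add: is_zero_object_def)
  show "epic C g" if ex: "exact_at C g (Zero C Y Z)"
  proof (rule epicI[OF g])
    obtain m c where c: "is_cokernel C c g" and mc: "is_kernel C m c"
      and m: "is_kernel C m (Zero C Y Z)"
      using ex unfolding exact_at_def is_image_def by blast
    note c' = cokernelD[OF c] and m' = kernelD[OF m]
    obtain u where u: "u \<in> homs C Y (Dom C m)" "m \<cdot> u = Idt C Y"
      by (rule kernel_factor[OF m, of "Idt C Y" Y]) (use g' Zo in \<open>simp_all add: homs_def\<close>)
    have "(c \<cdot> m) \<cdot> u = Zero C Y (Cod C c)"
      using homsD[OF u(1)] kernelD(4)[OF mc] c' by simp
    then have c0: "c = Zero C Y (Cod C c)"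
      using u(2) homsD[OF u(1)] c' m' g' Zo by simp
    fix W h assume "h \<cdot> g = Zero C X W" "h \<in> homs C Y W"
    then obtain v where v: "v \<in> homs C (Cod C c) W" "v \<cdot> c = h"
      using cokernel_factor[OF c] g' by metis
    have "v \<cdot> Zero C Y (Cod C c) = Zero C Y W" using homsD[OF v(1)] g' by simp
    then show "h = Zero C Y W" using v(2) c0 by simp
  qed
  show "exact_at C g (Zero C Y Z)" if epi: "epic C g"
  proof -
    have zero_epic: "epic C (Zero C Y Z)"
      by (rule epicI[of _ Y Z]) (use zero_object_unique[OF Z] g' Zo in \<open>simp_all add: homs_def\<close>)
    have "is_cokernel C (Zero C Y Z) g"
    proof (rule is_cokernelI[OF zero_epic])
      fix W h assume h: "h \<in> homs C (Cod C g) W" "h \<cdot> g = Zero C (Dom C g) W"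
      note h' = homsD[OF h(1)]
      have "h = Zero C Y W"
        by (rule epic_cancel[OF epi]) (use h(2) h' g' in simp_all)
      then show "\<exists>u\<in>homs C (Cod C (Zero C Y Z)) W. u \<cdot> Zero C Y Z = h"
        using h' g' Zo by (intro bexI[of _ "Zero C Z W"]) (simp_all add: homs_def)
    qed (use g' Zo in simp_all)
    moreover have "is_kernel C (Idt C Y) (Zero C Y Z)"
      by (rule is_kernelI) (use g' Zo monic_Idt in \<open>simp_all add: homs_def\<close>)
    ultimately show ?thesis unfolding exact_at_def is_image_def by blast
  qed
qed

end

section \<open>Images and exactness in abelian categories\<close>

context abelian_category
begin

text \<open>If \<open>f\<close> is a kernel of \<open>g\<close>, then \<open>g\<close> kills
  \<open>f\<close> and factors as \<open>g1 \<cdot> c\<close>. Hence whatever \<open>c\<close> kills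
  is killed by \<open>g\<close> and factors through \<open>f\<close>.\<close>

lemma monic_is_kernel_of_cokernel:
  assumes "monic C f" "is_cokernel C c f"
  shows "is_kernel C f c"
proof -
  obtain g where g: "is_kernel C f g" using monic_is_kernel[OF assms(1)] by blast
  note c' = cokernelD[OF assms(2)] and g' = kernelD[OF g]
  obtain g1 where g1: "g1 \<in> homs C (Cod C c) (Cod C g)" "g1 \<cdot> c = g"
    by (rule cokernel_factor[OF assms(2), of g "Cod C g"]) (use g' in \<open>simp_all add: homs_def\<close>)
  note g1' = homsD[OF g1(1)]
  show ?thesis
  proof (rule is_kernelI[OF assms(1)])
    fix W h assume h: "h \<in> homs C W (Dom C c)" "c \<cdot> h = Zero C W (Cod C c)"
    note h' = homsD[OF h(1)]
    have "g1 \<cdot> c \<cdot> h = Zero C W (Cod C g)" using h(2) g1' h' by simp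
    then have "g \<cdot> h = Zero C W (Cod C g)"
      using comp_reassoc[OF g1(2), of h] g1' h' c' by simp
    then show "\<exists>u\<in>homs C W (Dom C f). f \<cdot> u = h"
      using kernel_factor[OF g, of h W] h(1) c'(3) g'(3) by metis
  qed (use c' in simp_all)
qed

lemma epic_is_cokernel_of_kernel:
  assumes "epic C e" "is_kernel C k e"
  shows "is_cokernel C e k"
proof -
  obtain g where g: "is_cokernel C e g" using epic_is_cokernel[OF assms(1)] by blast
  note k' = kernelD[OF assms(2)] and g' = cokernelD[OF g]
  obtain g1 where g1: "g1 \<in> homs C (Dom C g) (Dom C k)" "k \<cdot> g1 = g"
    by (rule kernel_factor[OF assms(2), of g "Dom C g"]) (use g' in \<open>simp_all add: homs_def\<close>)
  note g1' = homsD[OF g1(1)]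
  show ?thesis
  proof (rule is_cokernelI[OF assms(1)])
    fix W h assume h: "h \<in> homs C (Cod C k) W" "h \<cdot> k = Zero C (Dom C k) W"
    note h' = homsD[OF h(1)]
    have "(h \<cdot> k) \<cdot> g1 = Zero C (Dom C g) W" unfolding h(2) using g1' h' by simp
    then have "h \<cdot> g = Zero C (Dom C g) W"
      using g1(2) g1' h' k' by simp
    then show "\<exists>u\<in>homs C (Cod C e) W. u \<cdot> e = h"
      using cokernel_factor[OF g, of h W] h(1) k'(3) g'(3) by metis
  qed (use k' in simp_all)
qed

lemma monic_is_image:
  assumes "monic C f"
  shows "is_image C f f"
proof -
  have "f \<in> Ar C" using assms by (simp add: monic_def)
  then obtain c where "is_cokernel C c f" using has_cokernels by blast
  then show ?thesis using monic_is_kernel_of_cokernel assms unfolding is_image_def by blast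
qed

lemma image_comp_epic:
  assumes "epic C e" "Cod C e = Dom C f" "f \<in> Ar C"
  shows "is_image C m (f \<cdot> e) \<longleftrightarrow> is_image C m f"
  unfolding is_image_def cokernel_comp_epic[OF assms] ..

text \<open>If \<open>t\<close> kills \<open>e\<close>, then \<open>f\<close> factors through the monomorphism \<open>m \<cdot> ker t\<close>, hence so does its
  image \<open>m\<close>; this splits \<open>ker t\<close> and forces \<open>t = 0\<close>.\<close>

lemma image_factorization:
  assumes "is_image C m f"
  obtains e where "e \<in> homs C (Dom C f) (Dom C m)" "epic C e" "m \<cdot> e = f"
proof -
  obtain c where c: "is_cokernel C c f" and m: "is_kernel C m c"
    using assms unfolding is_image_def by blast
  note c' = cokernelD[OF c] and m' = kernelD[OF m]
  obtain e where e: "e \<in> homs C (Dom C f) (Dom C m)" "m \<cdot> e = f"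
    by (rule kernel_factor[OF m, of f "Dom C f"]) (use c' in \<open>simp_all add: homs_def\<close>)
  note e' = homsD[OF e(1)]
  have "epic C e"
  proof (rule epicI[OF e(1)])
    fix W t assume te: "t \<cdot> e = Zero C (Dom C f) W" and t: "t \<in> homs C (Dom C m) W"
    note t' = homsD[OF t]
    obtain k where k: "is_kernel C k t" using has_kernels t' by blast
    note k' = kernelD[OF k]
    obtain e1 where e1: "e1 \<in> homs C (Dom C f) (Dom C k)" "k \<cdot> e1 = e"
      by (rule kernel_factor[OF k, of e "Dom C f"]) (use te e' t' in \<open>simp_all add: homs_def\<close>)
    note e1' = homsD[OF e1(1)]
    have "monic C (m \<cdot> k)"
      by (rule monic_comp) (use kernel_monic[OF k] kernel_monic[OF m] k' t' in simp_all)
    \<comment> \<open>Since \<open>f\<close> factors through \<open>m \<cdot> k\<close>, the arrow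
      \<open>g\<close> kills \<open>f\<close>. So it factors through the cokernel \<open>c\<close>
      and kills \<open>m\<close>, the kernel of \<open>c\<close>; this is what makes
      \<open>m\<close> factor through \<open>m \<cdot> k\<close>.\<close>
    then obtain g where g: "is_kernel C (m \<cdot> k) g" using monic_is_kernel by blast
    have mk: "m \<cdot> k \<in> Ar C" "Dom C (m \<cdot> k) = Dom C k" "Cod C (m \<cdot> k) = Cod C m"
      using k' m' t' by simp_all
    note g' = kernelD[OF g, unfolded mk]
    have mke: "(m \<cdot> k) \<cdot> e1 = f" using e1(2) e(2) e1' k' m' t' by simp
    have "(g \<cdot> m \<cdot> k) \<cdot> e1 = Zero C (Dom C f) (Cod C g)"
      unfolding g'(4) using g' e1' by simp
    moreover have "(g \<cdot> m \<cdot> k) \<cdot> e1 = g \<cdot> (m \<cdot> k) \<cdot> e1"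
      by (rule comp_assoc) (use g' e1' mk in simp_all)
    ultimately have gf: "g \<cdot> f = Zero C (Dom C f) (Cod C g)"
      using mke by simp
    have mf: "Cod C m = Cod C f" using m' c' by simp
    obtain g1 where g1: "g1 \<in> homs C (Cod C c) (Cod C g)" "g1 \<cdot> c = g"
      by (rule cokernel_factor[OF c, of g "Cod C g"]) (use g' mf gf in \<open>simp_all add: homs_def\<close>)
    note g1' = homsD[OF g1(1)]
    have "g1 \<cdot> c \<cdot> m = Zero C (Dom C m) (Cod C g)" using g1' m' by simp
    then have "g \<cdot> m = Zero C (Dom C m) (Cod C g)"
      using comp_reassoc[OF g1(2), of m] g1' m' c' by simp
    then obtain l where l: "l \<in> homs C (Dom C m) (Dom C k)" "(m \<cdot> k) \<cdot> l = m"
      using kernel_factor[OF g, of m "Dom C m"] mk(2) g'(3) m'(1) unfolding homs_def by auto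
    note l' = homsD[OF l(1)]
    have "k \<cdot> l = Idt C (Dom C m)"
      by (rule monic_cancel[OF kernel_monic[OF m]]) (use l(2) l' k' m' t' in simp_all)
    moreover have "t \<cdot> k \<cdot> l = Zero C (Dom C m) W"
      using comp_reassoc[OF k'(4), of l] l' k' t' by simp
    ultimately show "t = Zero C (Dom C m) W" using t' by simp
  qed
  then show thesis using that e by blast
qed

lemma exact_at_comp:
  assumes "exact_at C f g"
  shows "f \<in> Ar C" "g \<in> Ar C" "Cod C f = Dom C g" "g \<cdot> f = Zero C (Dom C f) (Cod C g)"
proof -
  obtain m where m: "is_image C m f" "is_kernel C m g"
    using assms unfolding exact_at_def by blast
  obtain e where e: "e \<in> homs C (Dom C f) (Dom C m)" "m \<cdot> e = f"
    using image_factorization[OF m(1)] by blast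
  note m' = kernelD[OF m(2)] and e' = homsD[OF e(1)]
  show "f \<in> Ar C" "g \<in> Ar C" "Cod C f = Dom C g"
    using e(2) m' e' comp_simps[of e m] by simp_all
  have "g \<cdot> m \<cdot> e = (g \<cdot> m) \<cdot> e" by (rule comp_assoc[symmetric]) (use m' e' in simp_all)
  also have "\<dots> = Zero C (Dom C f) (Cod C g)" unfolding m'(4) using m' e' by simp
  finally show "g \<cdot> f = Zero C (Dom C f) (Cod C g)" unfolding e(2) .
qed

text \<open>This is the form in which exact functors are used: a monic together with its cokernel.
  The epic \<open>g\<close> is the cokernel of its kernel, which is the image of \<open>f\<close>,
  and replacing that image by \<open>f\<close> only adds an epic in front.\<close>

lemma short_exact_iff: "short_exact C f g \<longleftrightarrow> monic C f \<and> is_cokernel C g f"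
proof
  assume "short_exact C f g"
  then obtain Z where Z: "is_zero_object C Z" "exact_at C (Zero C Z (Dom C f)) f"
    and fg: "exact_at C f g" and g0: "exact_at C g (Zero C (Cod C g) Z)"
    unfolding short_exact_def by blast
  note ar = exact_at_comp[OF fg]
  have mono: "monic C f" using exact_at_Zero_left_iff[OF Z(1) Ar_homs[OF ar(1)]] Z(2) by simp
  have epi: "epic C g" using exact_at_Zero_right_iff[OF Z(1) Ar_homs[OF ar(2)]] g0 by simp
  obtain m where m: "is_image C m f" "is_kernel C m g"
    using fg unfolding exact_at_def by blast
  obtain e where e: "e \<in> homs C (Dom C f) (Dom C m)" "epic C e" "m \<cdot> e = f"
    using image_factorization[OF m(1)] .
  have "is_cokernel C g m" by (rule epic_is_cokernel_of_kernel[OF epi m(2)])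
  then have "is_cokernel C g f"
    using cokernel_comp_epic[OF e(2), of m g] e(3) homsD[OF e(1)] kernelD[OF m(2)] by simp
  then show "monic C f \<and> is_cokernel C g f" using mono by blast
next
  assume fg: "monic C f \<and> is_cokernel C g f"
  obtain Z where Z: "is_zero_object C Z" using has_zero_object by blast
  note g' = cokernelD[OF conjunct2[OF fg]]
  have "exact_at C f g"
    using fg monic_is_kernel_of_cokernel unfolding exact_at_def is_image_def by blast
  then show "short_exact C f g"
    using Z exact_at_Zero_left_iff[OF Z Ar_homs[OF g'(2)]]
      exact_at_Zero_right_iff[OF Z Ar_homs[OF g'(1)]] fg cokernel_epic
    unfolding short_exact_def by blast
qed

text \<open>Write \<open>h\<close> as an epic \<open>e\<close> followed by its image inclusion
  \<open>n\<close>. Exactness says that the kernel of \<open>e\<close> is the image of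
  \<open>f\<close>, so \<open>e\<close> and \<open>c\<close> have the same universal property and
  factor through each other. Thus \<open>g\<close> is \<open>n\<close> after a split monic.\<close>

lemma exact_at_monic_factor:
  assumes ex: "exact_at C f h" and c: "is_cokernel C c f"
    and g: "g \<in> homs C (Cod C c) (Cod C h)" and gc: "g \<cdot> c = h"
  shows "monic C g"
proof -
  obtain m c1 where m: "is_kernel C m h" and c1: "is_cokernel C c1 f" and m1: "is_kernel C m c1"
    using ex unfolding exact_at_def is_image_def by blast
  note c' = cokernelD[OF c] and m' = kernelD[OF m] and g' = homsD[OF g]
  note c1' = cokernelD[OF c1] and m1' = kernelD[OF m1] and h' = exact_at_comp[OF ex]
  obtain c2 where c2: "is_cokernel C c2 h" using has_cokernels m' by blast
  obtain n where nc2: "is_kernel C n c2" using has_kernels cokernelD(1)[OF c2] by blast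
  have n: "n \<in> homs C (Dom C n) (Cod C h)" "monic C n"
    using kernelD[OF nc2] cokernelD[OF c2] kernel_monic[OF nc2] by (simp_all add: homs_def)
  have "is_image C n h" using c2 nc2 unfolding is_image_def by blast
  then obtain e where e: "e \<in> homs C (Dom C h) (Dom C n)" "epic C e" "n \<cdot> e = h"
    by (rule image_factorization)
  note n' = homsD[OF n(1)] and e' = homsD[OF e(1)]
  \<comment> \<open>As \<open>n\<close> is monic, \<open>e\<close> kills exactly what
    \<open>h\<close> kills; the two therefore share the kernel \<open>m\<close>.\<close>
  have kills: "e \<cdot> x = Zero C W (Dom C n)" if "x \<in> homs C W (Dom C h)" "h \<cdot> x = Zero C W (Cod C h)"
    for x W
  proof (rule monic_cancel[OF n(2)])
    note x' = homsD[OF that(1)]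
    show "n \<cdot> e \<cdot> x = n \<cdot> Zero C W (Dom C n)"
      using comp_reassoc[OF e(3), of x] that(2) x' e' n' by simp
  qed (use homsD[OF that(1)] e' n' in simp_all)
  have em: "is_kernel C m e"
  proof (rule is_kernelI[OF kernel_monic[OF m]])
    show "e \<cdot> m = Zero C (Dom C m) (Cod C e)"
      using kills[of m "Dom C m"] m' e' by (simp add: homs_def)
    fix W x assume x: "x \<in> homs C W (Dom C e)" "e \<cdot> x = Zero C W (Cod C e)"
    note x' = homsD[OF x(1)]
    have "h \<cdot> x = Zero C W (Cod C h)"
      using comp_reassoc[OF e(3), of x] x(2) x' e' n' by simp
    then show "\<exists>u\<in>homs C W (Dom C m). m \<cdot> u = x"
      using kernel_factor[OF m, of x W] x(1) e' by metis
  qed (use e' m' in simp_all)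
  have e_coker: "is_cokernel C e m" by (rule epic_is_cokernel_of_kernel[OF e(2) em])
  \<comment> \<open>Exactness provides \<open>m\<close> as a kernel of some cokernel
    \<open>c1\<close> of \<open>f\<close>, not of the given \<open>c\<close>; the comparison
    \<open>v\<close> shows that \<open>c\<close> kills \<open>m\<close> too.\<close>
  obtain v where v: "v \<in> homs C (Cod C c1) (Cod C c)" "v \<cdot> c1 = c"
    by (rule cokernel_factor[OF c1, of c "Cod C c"]) (use c' in \<open>simp_all add: homs_def\<close>)
  note v' = homsD[OF v(1)]
  have "v \<cdot> c1 \<cdot> m = Zero C (Dom C m) (Cod C c)" using m1' v' by simp
  then have cm: "c \<cdot> m = Zero C (Dom C m) (Cod C c)"
    using comp_reassoc[OF v(2), of m] m1' v' c1' by simp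
  have cd: "Dom C c = Dom C h" "Cod C m = Dom C h" "Cod C f = Dom C h" using c' h' m' by simp_all
  obtain b where b: "b \<in> homs C (Dom C n) (Cod C c)" "b \<cdot> e = c"
    using cokernel_factor[OF e_coker, of c "Cod C c"] cm cd c'(1) e' unfolding homs_def by auto
  have "e \<cdot> f = Zero C (Dom C f) (Dom C n)"
    using kills[of f "Dom C f"] h' by (simp add: homs_def)
  then obtain a where a: "a \<in> homs C (Cod C c) (Dom C n)" "a \<cdot> c = e"
    using cokernel_factor[OF c, of e "Dom C n"] cd e' unfolding homs_def by auto
  note a' = homsD[OF a(1)] and b' = homsD[OF b(1)]
  have ba: "b \<cdot> a = Idt C (Cod C c)"
    by (rule epic_cancel[OF cokernel_epic[OF c]]) (use a b a' b' c' in simp_all)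
  have "n \<cdot> a = g"
    by (rule epic_cancel[OF cokernel_epic[OF c]]) (use a e gc g' a' n' c' in simp_all)
  moreover have "monic C (n \<cdot> a)"
    by (rule monic_comp[OF split_monic[OF a(1) b(1) ba] n(2)]) (use a' n' in simp)
  ultimately show ?thesis by simp
qed

end

section \<open>Torsionfree objects through iterated cokernels\<close>

definition approx_embedding :: "('o, 'm, 'z) cat_scheme \<Rightarrow> 'm \<Rightarrow> bool" where
  "approx_embedding C f \<longleftrightarrow> monic C f \<and> left_projective_approximation C f"

text \<open>Each step passes to a cosyzygy, the cokernel of some monic approximation. The choice is
  existential; its irrelevance is proved in \<open>torsionfree_rec_cokernel_unique\<close>. Starting
  from all objects leaves at level 1 just the existence of a monic approximation, since cokernels
  exist.\<close>

primrec torsionfree_rec :: "('o, 'm, 'z) acat_scheme \<Rightarrow> nat \<Rightarrow> 'o set" where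
  "torsionfree_rec C 0 = Ob C"
| "torsionfree_rec C (Suc n) = {M. \<exists>f c. approx_embedding C f \<and> Dom C f = M \<and>
    is_cokernel C c f \<and> Cod C c \<in> torsionfree_rec C n}"

text \<open>The exact sequences in the definition of \<open>torsionfree\<close>, reindexed so that
  \<open>f i\<close> goes from \<open>P i\<close> to \<open>P (i + 1)\<close>.\<close>

definition torsionfree_seq ::
  "('o, 'm, 'z) acat_scheme \<Rightarrow> nat \<Rightarrow> (nat \<Rightarrow> 'o) \<Rightarrow> (nat \<Rightarrow> 'm) \<Rightarrow> bool" where
  "torsionfree_seq C n P f \<longleftrightarrow> monic C (f 0) \<and>
    (\<forall>i<n. P (Suc i) \<in> projectives C \<and> f i \<in> homs C (P i) (P (Suc i)) \<and>
      (\<exists>m. is_image C m (f i) \<and> left_projective_approximation C m)) \<and>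
    (\<forall>i. Suc i < n \<longrightarrow> exact_at C (f i) (f (Suc i)))"

lemma projective_lift:
  assumes "P \<in> projectives C" "epic C e" "f \<in> homs C P (Cod C e)"
  obtains g where "g \<in> homs C P (Dom C e)" "Cmp C e g = f"
  using assms unfolding projectives_def by blast

lemma approximation_factor:
  assumes "left_projective_approximation C f" "Q \<in> projectives C" "h \<in> homs C (Dom C f) Q"
  obtains u where "u \<in> homs C (Cod C f) Q" "Cmp C u f = h"
  using assms unfolding left_projective_approximation_def by blast

context abelian_category
begin

text \<open>Both \<open>f\<close> and \<open>m\<close> are kernels of \<open>c\<close>, hence the
  same subobject. The comparison arrows satisfy \<open>d \<cdot> e = 1\<close>, so an extension of
  \<open>h \<cdot> d\<close> along \<open>m\<close> is an extension of \<open>h\<close> along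
  \<open>f\<close>.\<close>

lemma monic_image_approximation:
  assumes "monic C f" "is_image C m f" "left_projective_approximation C m"
  shows "approx_embedding C f"
proof -
  obtain c where c: "is_cokernel C c f" and m: "is_kernel C m c"
    using assms(2) unfolding is_image_def by blast
  have f: "is_kernel C f c" by (rule monic_is_kernel_of_cokernel[OF assms(1) c])
  note m' = kernelD[OF m] and f' = kernelD[OF f]
  obtain e where e: "e \<in> homs C (Dom C f) (Dom C m)" "m \<cdot> e = f"
    by (rule kernel_factor[OF m, of f "Dom C f"]) (use f' in \<open>simp_all add: homs_def\<close>)
  obtain d where d: "d \<in> homs C (Dom C m) (Dom C f)" "f \<cdot> d = m"
    by (rule kernel_factor[OF f, of m "Dom C m"]) (use m' in \<open>simp_all add: homs_def\<close>)
  note e' = homsD[OF e(1)] and d' = homsD[OF d(1)]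
  have de: "d \<cdot> e = Idt C (Dom C f)"
  proof (rule monic_cancel[OF assms(1)])
    show "f \<cdot> d \<cdot> e = f \<cdot> Idt C (Dom C f)"
      using comp_reassoc[OF d(2), of e] e d' e' f' by simp
  qed (use e' d' f' in simp_all)
  have "\<exists>u\<in>homs C (Cod C f) Q. u \<cdot> f = h"
    if Q: "Q \<in> projectives C" and h: "h \<in> homs C (Dom C f) Q" for Q h
  proof -
    note h' = homsD[OF h]
    have "h \<cdot> d \<in> homs C (Dom C m) Q" using h' d' by (simp add: homs_def)
    then obtain u where u: "u \<in> homs C (Cod C m) Q" "u \<cdot> m = h \<cdot> d"
      by (rule approximation_factor[OF assms(3) Q])
    note u' = homsD[OF u(1)]
    have "u \<cdot> m \<cdot> e = (h \<cdot> d) \<cdot> e"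
      by (rule comp_reassoc[OF u(2)]) (use e' u' m' in simp_all)
    also have "\<dots> = h" using de h' d' e' by simp
    finally show ?thesis using u(1) e(2) m' f' by auto
  qed
  moreover have "Cod C f \<in> projectives C"
    using assms(3) m' f' by (simp add: left_projective_approximation_def)
  ultimately show ?thesis
    using assms(1) f' by (simp add: approx_embedding_def left_projective_approximation_def)
qed

lemma kernel_comp_monic:
  assumes k: "is_kernel C k c" and g: "monic C g" "Dom C g = Cod C c"
  shows "is_kernel C k (g \<cdot> c)"
proof (rule is_kernelI[OF kernel_monic[OF k]])
  note k' = kernelD[OF k]
  have g': "g \<in> Ar C" "Cod C g \<in> Ob C" using g(1) cod_in_Ob by (auto simp: monic_def)
  show "g \<cdot> c \<in> Ar C" "Cod C k = Dom C (g \<cdot> c)" using g' g(2) k' by simp_all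
  show "(g \<cdot> c) \<cdot> k = Zero C (Dom C k) (Cod C (g \<cdot> c))" using g' g(2) k' by simp
  fix W h assume h: "h \<in> homs C W (Dom C (g \<cdot> c))" "(g \<cdot> c) \<cdot> h = Zero C W (Cod C (g \<cdot> c))"
  note h' = homsD[OF h(1)]
  have "c \<cdot> h = Zero C W (Cod C c)"
    by (rule monic_cancel[OF g(1)]) (use h(2) h' g' g(2) k' in simp_all)
  then show "\<exists>u\<in>homs C W (Dom C k). k \<cdot> u = h"
    using kernel_factor[OF k, of h W] h(1) g' g(2) k' by (metis comp_simps(2))
qed

lemma torsionfree_iff_seq:
  assumes "n \<ge> 1"
  shows "M \<in> torsionfree C n \<longleftrightarrow> (\<exists>P f. P 0 = M \<and> torsionfree_seq C n P f)"
proof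
  assume "M \<in> torsionfree C n"
  then obtain P f Z where P0: "P 0 = M" and Z: "is_zero_object C Z"
    and Pf: "\<And>i. i \<in> {1..n} \<Longrightarrow> P i \<in> projectives C \<and> f i \<in> homs C (P (i - 1)) (P i)"
    and ex0: "exact_at C (Zero C Z M) (f 1)"
    and ex: "\<And>i. i \<in> {1..<n} \<Longrightarrow> exact_at C (f i) (f (i + 1))"
    and im: "\<And>i. i \<in> {1..n} \<Longrightarrow> \<exists>m. is_image C m (f i) \<and> left_projective_approximation C m"
    unfolding torsionfree_def by blast
  have "f 1 \<in> homs C M (P 1)" using Pf[of 1] P0 assms by simp
  then have "monic C (f 1)" using exact_at_Zero_left_iff[OF Z] ex0 by blast
  moreover have "P (Suc i) \<in> projectives C \<and> f (Suc i) \<in> homs C (P i) (P (Suc i)) \<and>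
      (\<exists>m. is_image C m (f (Suc i)) \<and> left_projective_approximation C m)" if "i < n" for i
    using Pf[of "Suc i"] im[of "Suc i"] that by auto
  moreover have "exact_at C (f (Suc i)) (f (Suc (Suc i)))" if "Suc i < n" for i
    using ex[of "Suc i"] that by simp
  ultimately have "torsionfree_seq C n P (\<lambda>i. f (Suc i))"
    unfolding torsionfree_seq_def by simp
  then show "\<exists>P f. P 0 = M \<and> torsionfree_seq C n P f" using P0 by blast
next
  assume "\<exists>P f. P 0 = M \<and> torsionfree_seq C n P f"
  then obtain P f where P0: "P 0 = M" and mono: "monic C (f 0)"
    and Pf: "\<And>i. i < n \<Longrightarrow> P (Suc i) \<in> projectives C \<and> f i \<in> homs C (P i) (P (Suc i)) \<and>
      (\<exists>m. is_image C m (f i) \<and> left_projective_approximation C m)"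
    and ex: "\<And>i. Suc i < n \<Longrightarrow> exact_at C (f i) (f (Suc i))"
    unfolding torsionfree_seq_def by blast
  obtain Z where Z: "is_zero_object C Z" using has_zero_object by blast
  have f0: "f 0 \<in> homs C M (P 1)" using Pf[of 0] assms P0 by simp
  \<comment> \<open>The subtractions stay unevaluated so that these facts match the witness
    \<open>\<lambda>i. f (i - 1)\<close> below. All indices are at least 1, so truncated subtraction
    does no harm.\<close>
  have "exact_at C (Zero C Z M) (f (1 - 1))" using exact_at_Zero_left_iff[OF Z f0] mono by simp
  moreover have "P i \<in> projectives C \<and> f (i - 1) \<in> homs C (P (i - 1)) (P i) \<and>
      (\<exists>m. is_image C m (f (i - 1)) \<and> left_projective_approximation C m)" if "i \<in> {1..n}" for i
    using Pf[of "i - 1"] that by (cases i) auto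
  moreover have "exact_at C (f (i - 1)) (f (i + 1 - 1))" if "i \<in> {1..<n}" for i
    using ex[of "i - 1"] that by (cases i) auto
  moreover have "M \<in> Ob C" using homsD[OF f0] by blast
  ultimately show "M \<in> torsionfree C n"
    unfolding torsionfree_def using P0 Z
    by (intro CollectI conjI exI[of _ P] exI[of _ "\<lambda>i. f (i - 1)"] exI[of _ Z]) blast+
qed

lemma torsionfree_seqD:
  assumes "torsionfree_seq C (Suc n) P f"
  shows "f 0 \<in> homs C (P 0) (P 1)" "approx_embedding C (f 0)"
  using assms monic_image_approximation unfolding torsionfree_seq_def by auto

lemma torsionfree_one: "torsionfree C 1 = torsionfree_rec C 1"
proof (intro Set.set_eqI iffI)
  fix M assume "M \<in> torsionfree C 1"
  then obtain P f where Pf: "P 0 = M" "torsionfree_seq C (Suc 0) P f"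
    using torsionfree_iff_seq[of 1] by auto
  note f = torsionfree_seqD[OF Pf(2)]
  obtain c where "is_cokernel C c (f 0)" using has_cokernels homsD[OF f(1)] by blast
  then show "M \<in> torsionfree_rec C 1"
    using f Pf(1) homsD[OF f(1)] cokernelD(7) by auto
next
  fix M assume "M \<in> torsionfree_rec C 1"
  then obtain f where f: "approx_embedding C f" "Dom C f = M" by auto
  then have "torsionfree_seq C 1 (case_nat M (\<lambda>_. Cod C f)) (\<lambda>_. f)"
    using monic_is_image
    by (auto simp: torsionfree_seq_def approx_embedding_def left_projective_approximation_def homs_def)
  moreover have "case_nat M (\<lambda>_. Cod C f) 0 = M" by simp
  ultimately show "M \<in> torsionfree C 1" using torsionfree_iff_seq[of 1] by blast
qed

text \<open>The second map of the sequence factors as the cokernel \<open>c\<close> of the first one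
  followed by an arrow \<open>g\<close>, monic by exactness. Since \<open>c\<close> is epic,
  \<open>g\<close> and the second map have the same image, so every condition transfers between the
  sequence of \<open>M\<close> and the shorter one of \<open>Cod C c\<close>. The bound on
  \<open>n\<close> ensures that a second map exists.\<close>

lemma torsionfree_Suc:
  assumes "n \<ge> 1"
  shows "M \<in> torsionfree C (Suc n) \<longleftrightarrow> (\<exists>f c. approx_embedding C f \<and> Dom C f = M \<and>
    is_cokernel C c f \<and> Cod C c \<in> torsionfree C n)"
proof
  assume "M \<in> torsionfree C (Suc n)"
  then obtain P f where P0: "P 0 = M" and seq: "torsionfree_seq C (Suc n) P f"
    using torsionfree_iff_seq[of "Suc n"] by auto
  note f0 = torsionfree_seqD[OF seq]
  have Pf: "P (Suc i) \<in> projectives C \<and> f i \<in> homs C (P i) (P (Suc i)) \<and>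
      (\<exists>m. is_image C m (f i) \<and> left_projective_approximation C m)" if "i < Suc n" for i
    using seq that unfolding torsionfree_seq_def by blast
  have ex: "exact_at C (f i) (f (Suc i))" if "i < n" for i
    using seq that unfolding torsionfree_seq_def by blast
  obtain c where c: "is_cokernel C c (f 0)" using has_cokernels homsD[OF f0(1)] by blast
  have f1: "f (Suc 0) \<in> homs C (P 1) (P 2)" "exact_at C (f 0) (f (Suc 0))"
    using Pf[of 1] ex[of 0] assms by (auto simp: numeral_2_eq_2)
  note f0' = homsD[OF f0(1)] and f1' = homsD[OF f1(1)] and c' = cokernelD[OF c]
  obtain g where g: "g \<in> homs C (Cod C c) (P 2)" "g \<cdot> c = f (Suc 0)"
    by (rule cokernel_factor[OF c, of "f (Suc 0)" "P 2"])
      (use f1 f1' f0' exact_at_comp(4)[OF f1(2)] in \<open>simp_all add: homs_def\<close>)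
  note g' = homsD[OF g(1)]
  have mono: "monic C g" by (rule exact_at_monic_factor[OF f1(2) c _ g(2)]) (use g f1' in simp)
  have img: "is_image C m (f (Suc 0)) \<longleftrightarrow> is_image C m g" for m
    using image_comp_epic[OF cokernel_epic[OF c], of g m] g g' by simp
  \<comment> \<open>\<open>P 0\<close> and \<open>P 1\<close> are traded for the cokernel, and
    \<open>f 0\<close>, \<open>f 1\<close> for \<open>g\<close>; from there on the old sequence is
    shifted by one.\<close>
  define P' where "P' = case_nat (Cod C c) (\<lambda>i. P (Suc (Suc i)))"
  define f' where "f' = case_nat g (\<lambda>i. f (Suc (Suc i)))"
  have "P' (Suc i) \<in> projectives C \<and> f' i \<in> homs C (P' i) (P' (Suc i)) \<and>
      (\<exists>m. is_image C m (f' i) \<and> left_projective_approximation C m)" if "i < n" for i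
    using Pf[of "Suc i"] that g(1) img
    by (cases i) (auto simp: P'_def f'_def numeral_2_eq_2)
  moreover have "exact_at C (f' i) (f' (Suc i))" if "Suc i < n" for i
    using ex[of "Suc i"] that img by (cases i) (auto simp: f'_def exact_at_def)
  ultimately have "torsionfree_seq C n P' f'"
    using mono unfolding torsionfree_seq_def by (simp add: f'_def)
  moreover have "P' 0 = Cod C c" by (simp add: P'_def)
  ultimately have "Cod C c \<in> torsionfree C n" using torsionfree_iff_seq[OF assms] by blast
  then show "\<exists>f c. approx_embedding C f \<and> Dom C f = M \<and>
    is_cokernel C c f \<and> Cod C c \<in> torsionfree C n"
    using f0 f0' P0 c by blast
next
  assume "\<exists>f c. approx_embedding C f \<and> Dom C f = M \<and>
    is_cokernel C c f \<and> Cod C c \<in> torsionfree C n"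
  then obtain f c where f: "approx_embedding C f" "Dom C f = M" and c: "is_cokernel C c f"
    and K: "Cod C c \<in> torsionfree C n" by blast
  obtain P g where P0: "P 0 = Cod C c" and seq: "torsionfree_seq C n P g"
    using K torsionfree_iff_seq[OF assms] by blast
  have mono: "monic C (g 0)" using seq unfolding torsionfree_seq_def by blast
  have Pg: "P (Suc i) \<in> projectives C \<and> g i \<in> homs C (P i) (P (Suc i)) \<and>
      (\<exists>m. is_image C m (g i) \<and> left_projective_approximation C m)" if "i < n" for i
    using seq that unfolding torsionfree_seq_def by blast
  have ex: "exact_at C (g i) (g (Suc i))" if "Suc i < n" for i
    using seq that unfolding torsionfree_seq_def by blast
  note c' = cokernelD[OF c]
  have g0: "g 0 \<in> homs C (Cod C c) (P (Suc 0))" using Pg[of 0] assms P0 by simp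
  note g0' = homsD[OF g0]
  have img: "is_image C m (g 0 \<cdot> c) \<longleftrightarrow> is_image C m (g 0)" for m
    by (rule image_comp_epic[OF cokernel_epic[OF c]]) (use g0' in simp_all)
  \<comment> \<open>Splicing: the term \<open>P 0 = Cod C c\<close> disappears inside the composite
    \<open>g 0 \<cdot> c\<close>, while \<open>M\<close> and \<open>Cod C f\<close> are put in
    front.\<close>
  define P' where "P' = case_nat M (case_nat (Cod C f) (\<lambda>i. P (Suc i)))"
  define f' where "f' = case_nat f (case_nat (g 0 \<cdot> c) (\<lambda>i. g (Suc i)))"
  have f_kernel: "is_kernel C f (g 0 \<cdot> c)"
    by (rule kernel_comp_monic[OF monic_is_kernel_of_cokernel[OF _ c] mono])
      (use f g0' in \<open>simp_all add: approx_embedding_def\<close>)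
  have f_image: "is_image C f f" using monic_is_image f by (simp add: approx_embedding_def)
  have gc: "g 0 \<cdot> c \<in> homs C (Cod C f) (P (Suc 0))"
    using g0' c' by (simp add: homs_def)
  have fh: "f \<in> homs C M (Cod C f)" using f c' by (simp add: homs_def)
  have "P' (Suc i) \<in> projectives C \<and> f' i \<in> homs C (P' i) (P' (Suc i)) \<and>
      (\<exists>m. is_image C m (f' i) \<and> left_projective_approximation C m)" if i: "i < Suc n" for i
  proof (cases i)
    case 0
    then show ?thesis using f fh f_image
      by (auto simp: P'_def f'_def approx_embedding_def left_projective_approximation_def)
  next
    case (Suc k)
    then show ?thesis using Pg[of k] i gc img
      by (cases k) (auto simp: P'_def f'_def)
  qed
  moreover have "exact_at C (f' i) (f' (Suc i))" if i: "Suc i < Suc n" for i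
  proof (cases i)
    case 0
    then show ?thesis using f_image f_kernel by (auto simp: f'_def exact_at_def)
  next
    case (Suc k)
    then show ?thesis using ex[of k] i img by (cases k) (auto simp: f'_def exact_at_def)
  qed
  ultimately have "torsionfree_seq C (Suc n) P' f'"
    using f unfolding torsionfree_seq_def by (simp add: f'_def approx_embedding_def)
  moreover have "P' 0 = M" by (simp add: P'_def)
  ultimately show "M \<in> torsionfree C (Suc n)" using torsionfree_iff_seq[of "Suc n"] by auto
qed

lemma torsionfree_eq_rec: "n \<ge> 1 \<Longrightarrow> torsionfree C n = torsionfree_rec C n"
proof (induction n rule: nat_induct_at_least)
  case base
  show ?case by (rule torsionfree_one)
next
  case (Suc n)
  show ?case using torsionfree_Suc[OF Suc.hyps] Suc.IH by auto
qed

end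

section \<open>Stability under projective summands\<close>

context preadditive_category
begin

lemma projective_direct_sum:
  assumes P: "P \<in> projectives C" and Q: "Q \<in> projectives C" and S: "is_direct_sum C P Q S"
  shows "S \<in> projectives C"
proof -
  obtain i j p q where b: "is_biproduct C P Q S i j p q" using S unfolding is_direct_sum_def by blast
  note b' = biproductD[OF b]
  note ar = b'(1-4)[THEN homsD(1)] b'(1-4)[THEN homsD(2)] b'(1-4)[THEN homsD(3)]
  have "\<exists>g\<in>homs C S (Dom C e). e \<cdot> g = f" if e: "epic C e" and f: "f \<in> homs C S (Cod C e)" for e f
  proof -
    note f' = homsD[OF f]
    have e': "e \<in> Ar C" using e by (simp add: epic_def)
    obtain g1 where g1: "g1 \<in> homs C P (Dom C e)" "e \<cdot> g1 = f \<cdot> i"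
      by (rule projective_lift[OF P e, of "f \<cdot> i"]) (use f' ar in \<open>simp_all add: homs_def\<close>)
    obtain g2 where g2: "g2 \<in> homs C Q (Dom C e)" "e \<cdot> g2 = f \<cdot> j"
      by (rule projective_lift[OF Q e, of "f \<cdot> j"]) (use f' ar in \<open>simp_all add: homs_def\<close>)
    note g1' = homsD[OF g1(1)] and g2' = homsD[OF g2(1)]
    have "e \<cdot> (g1 \<cdot> p \<oplus> g2 \<cdot> q) = (f \<cdot> i) \<cdot> p \<oplus> (f \<cdot> j) \<cdot> q"
      using g1' g2' e' ar comp_reassoc[OF g1(2), of p] comp_reassoc[OF g2(2), of q] by simp
    then have "e \<cdot> (g1 \<cdot> p \<oplus> g2 \<cdot> q) = f" using biproduct_decompose(1)[OF b f] by simp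
    then show ?thesis
      using g1' g2' ar by (intro bexI[of _ "g1 \<cdot> p \<oplus> g2 \<cdot> q"]) (simp_all add: homs_def)
  qed
  then show ?thesis using homsD(5)[OF b'(1)] unfolding projectives_def by blast
qed

end

context abelian_category
begin

text \<open>If \<open>f : M \<rightarrow> P\<close> is an embedding with cokernel \<open>c\<close>, then \<open>f \<oplus> 1 : M \<oplus> Q \<rightarrow> P \<oplus> Q\<close> has the same
  cokernel object.\<close>

lemma torsionfree_rec_plus_projective:
  assumes M: "M \<in> torsionfree_rec C n" and Q: "Q \<in> projectives C" and E: "is_direct_sum C M Q E"
  shows "E \<in> torsionfree_rec C n"
proof (cases n)
  case 0
  then show ?thesis using E by (auto simp: is_direct_sum_def is_biproduct_def)
next
  case (Suc k)
  then obtain f c where f: "approx_embedding C f" "Dom C f = M" and c: "is_cokernel C c f"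
    and L: "Cod C c \<in> torsionfree_rec C k" using M by auto
  note c' = cokernelD[OF c]
  have mono: "monic C f" and lpa: "left_projective_approximation C f"
    using f by (auto simp: approx_embedding_def)
  define P where "P = Cod C f"
  have P: "P \<in> projectives C" using lpa by (simp add: left_projective_approximation_def P_def)
  have f': "f \<in> Ar C" "Dom C f = M" "Cod C f = P" "M \<in> Ob C" "P \<in> Ob C"
    using c' f(2) by (auto simp: P_def)
  obtain S where S: "is_direct_sum C P Q S"
    using has_direct_sums[OF f'(5)] Q unfolding projectives_def by blast
  obtain i j p q where b: "is_biproduct C M Q E i j p q" using E unfolding is_direct_sum_def by blast
  obtain i1 j1 p1 q1 where b1: "is_biproduct C P Q S i1 j1 p1 q1"
    using S unfolding is_direct_sum_def by blast
  note bi = biproductD[OF b] and bi1 = biproductD[OF b1]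
  note ar = bi(1-4)[THEN homsD(1)] bi(1-4)[THEN homsD(2)] bi(1-4)[THEN homsD(3)]
    bi(1,2)[THEN homsD(4)] homsD(5)[OF bi(1)]
  note ar1 = bi1(1-4)[THEN homsD(1)] bi1(1-4)[THEN homsD(2)] bi1(1-4)[THEN homsD(3)]
    homsD(5)[OF bi1(1)]
  define g where "g = i1 \<cdot> f \<cdot> p \<oplus> j1 \<cdot> q"
  have g: "g \<in> Ar C" "Dom C g = E" "Cod C g = S" using ar ar1 f' by (simp_all add: g_def)
  have pg: "p1 \<cdot> g = f \<cdot> p"
    using ar ar1 f' bi1 comp_reassoc[OF bi1(5), of "f \<cdot> p"] comp_reassoc[OF bi1(8), of q]
    by (simp add: g_def)
  have qg: "q1 \<cdot> g = q"
    using ar ar1 f' bi1 comp_reassoc[OF bi1(7), of "f \<cdot> p"] comp_reassoc[OF bi1(6), of q]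
    by (simp add: g_def)
  have gi: "g \<cdot> i = i1 \<cdot> f" using ar ar1 f' bi by (simp add: g_def)
  have gj: "g \<cdot> j = j1" using ar ar1 f' bi by (simp add: g_def)
  have g_monic: "monic C g"
  proof (rule monicI[of _ E S])
    fix W x assume gx: "g \<cdot> x = Zero C W S" and x: "x \<in> homs C W E"
    note x' = homsD[OF x]
    have "f \<cdot> p \<cdot> x = p1 \<cdot> g \<cdot> x" using comp_reassoc[OF pg, of x] x' g ar ar1 f' by simp
    then have fpx: "f \<cdot> p \<cdot> x = Zero C W P" using gx ar1 x' by simp
    have px: "p \<cdot> x = Zero C W M"
      by (rule monic_cancel[OF mono]) (use fpx x' f' ar in simp_all)
    have "q \<cdot> x = q1 \<cdot> g \<cdot> x" using comp_reassoc[OF qg, of x] x' g ar1 by simp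
    then have "q \<cdot> x = Zero C W Q" using gx ar1 x' by simp
    then show "x = Zero C W E" using biproduct_decompose(2)[OF b x] px x' ar by simp
  qed (use g in \<open>simp add: homs_def\<close>)
  have "\<exists>w\<in>homs C S R. w \<cdot> g = h" if R: "R \<in> projectives C" and h: "h \<in> homs C E R" for R h
  proof -
    note h' = homsD[OF h]
    \<comment> \<open>Only the \<open>M\<close>-component of \<open>h\<close> needs the
      approximation property; on \<open>Q\<close> the new map is the identity, so
      \<open>h \<cdot> j\<close> extends as it stands.\<close>
    obtain u where u: "u \<in> homs C P R" "u \<cdot> f = h \<cdot> i"
      using approximation_factor[OF lpa R, of "h \<cdot> i"] h' ar f' by (auto simp: homs_def)
    note u' = homsD[OF u(1)]
    have "(u \<cdot> p1 \<oplus> (h \<cdot> j) \<cdot> q1) \<cdot> g = u \<cdot> p1 \<cdot> g \<oplus> h \<cdot> j \<cdot> q1 \<cdot> g"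
      using u' h' ar ar1 g by simp
    also have "\<dots> = (h \<cdot> i) \<cdot> p \<oplus> (h \<cdot> j) \<cdot> q"
      using comp_reassoc[OF u(2), of p] u' h' ar f' by (simp add: pg qg)
    also have "\<dots> = h" by (rule biproduct_decompose(1)[OF b h])
    finally show ?thesis
      using u' h' ar ar1 by (intro bexI[of _ "u \<cdot> p1 \<oplus> (h \<cdot> j) \<cdot> q1"]) (simp_all add: homs_def)
  qed
  then have "approx_embedding C g"
    using g_monic g projective_direct_sum[OF P Q S]
    by (simp add: approx_embedding_def left_projective_approximation_def)
  moreover have "is_cokernel C (c \<cdot> p1) g"
  proof (rule is_cokernelI)
    have cP: "Dom C c = P" using c' by (simp add: P_def)
    show "epic C (c \<cdot> p1)"
      by (rule epic_comp[OF split_epic[OF bi1(1,3,5)] cokernel_epic[OF c]]) (use cP ar1 in simp)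
    show "g \<in> Ar C" "Dom C (c \<cdot> p1) = Cod C g" using g c' cP ar1 by simp_all
    have "c \<cdot> f \<cdot> p = Zero C E (Cod C c)"
      using comp_reassoc[OF c'(4), of p] c' f' ar by simp
    then show "(c \<cdot> p1) \<cdot> g = Zero C (Dom C g) (Cod C (c \<cdot> p1))"
      using g c' cP ar1 by (simp add: pg)
    fix W t assume t: "t \<in> homs C (Cod C g) W" "t \<cdot> g = Zero C (Dom C g) W"
    note t' = homsD[OF t(1), unfolded g]
    \<comment> \<open>On the summand \<open>Q\<close> the arrow \<open>g\<close> is
      \<open>j1\<close>, so \<open>t\<close> vanishes there and is determined by
      \<open>t \<cdot> i1\<close>, which kills \<open>f\<close> and descends along
      \<open>c\<close>.\<close>
    have "(t \<cdot> g) \<cdot> i = Zero C M W" using t(2) g t' ar by simp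
    then have tif: "(t \<cdot> i1) \<cdot> f = Zero C M W" using t' g ar ar1 f' by (simp add: gi)
    have "(t \<cdot> g) \<cdot> j = Zero C Q W" using t(2) g t' ar by simp
    then have tj: "t \<cdot> j1 = Zero C Q W" using t' g ar by (simp add: gj)
    obtain v where v: "v \<in> homs C (Cod C c) W" "v \<cdot> c = t \<cdot> i1"
      by (rule cokernel_factor[OF c, of "t \<cdot> i1" W])
        (use tif t' f' ar1 in \<open>simp_all add: homs_def\<close>)
    note v' = homsD[OF v(1)]
    have "t = (t \<cdot> i1) \<cdot> p1 \<oplus> (t \<cdot> j1) \<cdot> q1"
      using biproduct_decompose(1)[OF b1, of t W] t(1) g by simp
    also have "\<dots> = (t \<cdot> i1) \<cdot> p1" unfolding tj using t' ar1 by simp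
    also have "\<dots> = v \<cdot> c \<cdot> p1"
      unfolding v(2)[symmetric] by (rule comp_assoc) (use v' c' cP ar1 in simp_all)
    finally show "\<exists>u\<in>homs C (Cod C (c \<cdot> p1)) W. u \<cdot> c \<cdot> p1 = t"
      using v(1) c' cP ar1 by auto
  qed
  moreover have "Cod C (c \<cdot> p1) = Cod C c" using c' ar1 f' by simp
  ultimately show ?thesis
    unfolding Suc torsionfree_rec.simps
    using L g by (intro CollectI exI[of _ g] exI[of _ "c \<cdot> p1"]) simp
qed

text \<open>Restrict an embedding of \<open>M = M' \<oplus> Q\<close> to \<open>M'\<close>: the projection \<open>M \<rightarrow> Q\<close> extends along the
  approximation, so the new cokernel is the old one plus \<open>Q\<close>.\<close>

lemma torsionfree_rec_minus_projective:
  assumes M: "M \<in> torsionfree_rec C n" and Q: "Q \<in> projectives C" and M': "is_direct_sum C M' Q M"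
  shows "M' \<in> torsionfree_rec C n"
proof (cases n)
  case 0
  then show ?thesis using M' by (auto simp: is_direct_sum_def is_biproduct_def)
next
  case (Suc k)
  then obtain f c where f: "approx_embedding C f" "Dom C f = M" and c: "is_cokernel C c f"
    and L: "Cod C c \<in> torsionfree_rec C k" using M by auto
  note c' = cokernelD[OF c]
  have mono: "monic C f" and lpa: "left_projective_approximation C f"
    using f by (auto simp: approx_embedding_def)
  define P where "P = Cod C f"
  have f': "f \<in> Ar C" "Dom C f = M" "Cod C f = P" "M \<in> Ob C" "P \<in> Ob C" "Dom C c = P"
    using c' f(2) by (auto simp: P_def)
  obtain i j p q where b: "is_biproduct C M' Q M i j p q" using M' unfolding is_direct_sum_def by blast
  note bi = biproductD[OF b]
  note ar = bi(1-4)[THEN homsD(1)] bi(1-4)[THEN homsD(2)] bi(1-4)[THEN homsD(3)]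
    bi(1,2)[THEN homsD(4)]
  have fi: "f \<cdot> i \<in> Ar C" "Dom C (f \<cdot> i) = M'" "Cod C (f \<cdot> i) = P" using f' ar by simp_all
  have fi_monic: "monic C (f \<cdot> i)"
    by (rule monic_comp[OF split_monic[OF bi(1,3,5)] mono]) (use f' ar in simp)
  have "\<exists>u\<in>homs C P R. u \<cdot> f \<cdot> i = h" if R: "R \<in> projectives C" and h: "h \<in> homs C M' R" for R h
  proof -
    note h' = homsD[OF h]
    obtain v where v: "v \<in> homs C P R" "v \<cdot> f = h \<cdot> p"
      using approximation_factor[OF lpa R, of "h \<cdot> p"] h' ar f' by (auto simp: homs_def)
    have "v \<cdot> f \<cdot> i = (h \<cdot> p) \<cdot> i"
      by (rule comp_reassoc[OF v(2)]) (use homsD[OF v(1)] f' ar in simp_all)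
    also have "\<dots> = h" using h' ar bi by simp
    finally show ?thesis using v(1) by blast
  qed
  then have emb: "approx_embedding C (f \<cdot> i)"
    using fi_monic fi lpa
    by (simp add: approx_embedding_def left_projective_approximation_def P_def)
  obtain e where e: "is_cokernel C e (f \<cdot> i)" using has_cokernels fi by blast
  note e' = cokernelD[OF e, unfolded fi]
  define E where "E = Cod C e"
  have E: "Cod C e = E" "E \<in> Ob C" using e' by (simp_all add: E_def)
  \<comment> \<open>The extension \<open>w1\<close> of the projection \<open>q\<close> vanishes on
    \<open>f \<cdot> i\<close>, so it descends to the new cokernel \<open>E\<close>. The result
    \<open>w\<close> is a retraction of the map \<open>j'\<close> from \<open>Q\<close> to
    \<open>E\<close>.\<close>
  obtain w1 where w1: "w1 \<in> homs C P Q" "w1 \<cdot> f = q"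
    using approximation_factor[OF lpa Q, of q] bi(4) f' by auto
  note w1' = homsD[OF w1(1)]
  have w1fi: "w1 \<cdot> f \<cdot> i = Zero C M' Q"
    using comp_reassoc[OF w1(2), of i] bi(7) w1' f' ar by simp
  obtain w where w: "w \<in> homs C E Q" "w \<cdot> e = w1"
    using cokernel_factor[OF e, of w1 Q] w1 w1fi fi E by auto
  note w' = homsD[OF w(1)]
  have cfi: "c \<cdot> f \<cdot> i = Zero C M' (Cod C c)"
    using comp_reassoc[OF c'(4), of i] c' f' ar by simp
  obtain \<pi> where \<pi>: "\<pi> \<in> homs C E (Cod C c)" "\<pi> \<cdot> e = c"
    using cokernel_factor[OF e, of c "Cod C c"] cfi fi E c' f' by (auto simp: homs_def)
  note \<pi>' = homsD[OF \<pi>(1)]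
  define j' where "j' = e \<cdot> f \<cdot> j"
  have j': "j' \<in> homs C Q E" using e' E f' ar by (simp add: j'_def homs_def)
  have "w \<cdot> j' = w1 \<cdot> f \<cdot> j"
    using comp_reassoc[OF w(2), of "f \<cdot> j"] w' e' E f' ar by (simp add: j'_def)
  also have "\<dots> = Idt C Q" using comp_reassoc[OF w1(2), of j] w1' f' ar bi by simp
  finally have wj: "w \<cdot> j' = Idt C Q" .
  \<comment> \<open>Dividing \<open>E\<close> further by \<open>Q\<close> gives the old cokernel: if
    \<open>t\<close> kills \<open>j'\<close>, then \<open>t \<cdot> e\<close> kills \<open>f\<close>
    on both summands of \<open>M\<close>.\<close>
  have \<pi>_coker: "is_cokernel C \<pi> j'"
  proof (rule is_cokernelI)
    show "epic C \<pi>"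
      by (rule epic_of_comp[of _ e]) (use cokernel_epic[OF c] \<pi> \<pi>' e' E in simp_all)
    show "j' \<in> Ar C" "Dom C \<pi> = Cod C j'" using homsD[OF j'] \<pi>' by simp_all
    have "\<pi> \<cdot> j' = c \<cdot> f \<cdot> j"
      using comp_reassoc[OF \<pi>(2), of "f \<cdot> j"] \<pi>' e' E f' ar by (simp add: j'_def)
    also have "\<dots> = Zero C Q (Cod C c)"
      using comp_reassoc[OF c'(4), of j] c' f' ar by simp
    finally show "\<pi> \<cdot> j' = Zero C (Dom C j') (Cod C \<pi>)" using homsD[OF j'] \<pi>' by simp
    fix W t assume t: "t \<in> homs C (Cod C j') W" "t \<cdot> j' = Zero C (Dom C j') W"
    note t' = homsD[OF t(1), unfolded homsD(3)[OF j']]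
    have te: "t \<cdot> e \<in> Ar C" "Dom C (t \<cdot> e) = P" "Cod C (t \<cdot> e) = W" using t' e' E by simp_all
    have tei: "((t \<cdot> e) \<cdot> f) \<cdot> i = Zero C M' W"
      using t' e' E f' ar by simp
    have tej: "((t \<cdot> e) \<cdot> f) \<cdot> j = Zero C Q W"
      using t(2) t' e' E f' ar homsD[OF j'] by (simp add: j'_def)
    have "(t \<cdot> e) \<cdot> f \<in> homs C M W" using te f' by (simp add: homs_def)
    then have "(t \<cdot> e) \<cdot> f = Zero C M W"
      using biproduct_decompose(1)[OF b, of "(t \<cdot> e) \<cdot> f" W] ar f' t'
      unfolding tei tej by simp
    then obtain v where v: "v \<in> homs C (Cod C c) W" "v \<cdot> c = t \<cdot> e"
      using cokernel_factor[OF c, of "t \<cdot> e" W] te f' by (auto simp: homs_def)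
    note v' = homsD[OF v(1)]
    have "v \<cdot> \<pi> = t"
      by (rule epic_cancel[OF cokernel_epic[OF e]]) (use v v' \<pi> \<pi>' t' e' E in simp_all)
    then show "\<exists>u\<in>homs C (Cod C \<pi>) W. u \<cdot> \<pi> = t" using v(1) \<pi>' by auto
  qed
  have "is_direct_sum C (Cod C c) Q E"
    using split_direct_sum[OF j' w(1) wj \<pi>_coker] \<pi>' by simp
  then have "E \<in> torsionfree_rec C k" by (rule torsionfree_rec_plus_projective[OF L Q])
  then show ?thesis using emb fi e E Suc by auto
qed

text \<open>One half of Schanuel's lemma: the cokernel of \<open>(f, g) : M \<rightarrow> P \<oplus> Q\<close> is \<open>coker f \<oplus> Q\<close>
  as soon as \<open>g\<close> factors through \<open>f\<close>.\<close>

lemma cokernel_pair_direct_sum: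
  assumes c: "is_cokernel C c f" and f: "f \<in> homs C M P" and g: "g \<in> homs C M Q"
    and u: "u \<in> homs C P Q" and ufg: "u \<cdot> f \<oplus> g = Zero C M Q"
    and b: "is_biproduct C P Q S i j p q" and e: "is_cokernel C e (i \<cdot> f \<oplus> j \<cdot> g)"
  shows "is_direct_sum C (Cod C c) Q (Cod C e)"
proof -
  note bi = biproductD[OF b]
  note ar = bi(1-4)[THEN homsD(1)] bi(1-4)[THEN homsD(2)] bi(1-4)[THEN homsD(3)]
  note f' = homsD[OF f] and g' = homsD[OF g] and u' = homsD[OF u] and c' = cokernelD[OF c]
  define h where "h = i \<cdot> f \<oplus> j \<cdot> g"
  have h: "h \<in> Ar C" "Dom C h = M" "Cod C h = S" using f' g' ar by (simp_all add: h_def)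
  note e = e[folded h_def]
  note e' = cokernelD[OF e, unfolded h]
  define E where "E = Cod C e"
  have E: "Cod C e = E" "E \<in> Ob C" using e' by (simp_all add: E_def)
  have ph: "p \<cdot> h = f"
    using ar f' g' bi comp_reassoc[OF bi(5), of f] comp_reassoc[OF bi(8), of g] by (simp add: h_def)
  have qh: "q \<cdot> h = g"
    using ar f' g' bi comp_reassoc[OF bi(7), of f] comp_reassoc[OF bi(6), of g] by (simp add: h_def)
  \<comment> \<open>The sign in \<open>ufg\<close> is chosen for this line. The induced arrow
    \<open>r\<close> restricts to the identity on \<open>Q\<close>, because
    \<open>u \<cdot> p\<close> vanishes on \<open>j\<close>, and so it splits off the
    summand.\<close>
  have "(u \<cdot> p \<oplus> q) \<cdot> h = Zero C M Q" using ar u' h ph qh ufg by simp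
  then obtain r where r: "r \<in> homs C E Q" "r \<cdot> e = u \<cdot> p \<oplus> q"
    using cokernel_factor[OF e, of "u \<cdot> p \<oplus> q" Q] ar u' h E by (auto simp: homs_def)
  note r' = homsD[OF r(1)]
  have "(c \<cdot> p) \<cdot> h = Zero C M (Cod C c)" using ar c' f' h ph by simp
  then obtain \<pi> where \<pi>: "\<pi> \<in> homs C E (Cod C c)" "\<pi> \<cdot> e = c \<cdot> p"
    using cokernel_factor[OF e, of "c \<cdot> p" "Cod C c"] ar c' f' h E by (auto simp: homs_def)
  note \<pi>' = homsD[OF \<pi>(1)]
  have ej: "e \<cdot> j \<in> homs C Q E" using e' E ar by (simp add: homs_def)
  have rej: "r \<cdot> e \<cdot> j = Idt C Q"
    using comp_reassoc[OF r(2), of j] r' e' E ar u' bi by simp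
  have cp_epic: "epic C (c \<cdot> p)"
    by (rule epic_comp[OF split_epic[OF bi(1,3,5)] cokernel_epic[OF c]]) (use c' f' ar in simp)
  have "is_cokernel C \<pi> (e \<cdot> j)"
  proof (rule is_cokernelI)
    show "epic C \<pi>"
      by (rule epic_of_comp[of _ e]) (use cp_epic \<pi> \<pi>' e' E in simp_all)
    show "e \<cdot> j \<in> Ar C" "Dom C \<pi> = Cod C (e \<cdot> j)" using homsD[OF ej] \<pi>' by simp_all
    have "\<pi> \<cdot> e \<cdot> j = Zero C Q (Cod C c)"
      using comp_reassoc[OF \<pi>(2), of j] \<pi>' e' E ar bi c' f' g' by simp
    then show "\<pi> \<cdot> e \<cdot> j = Zero C (Dom C (e \<cdot> j)) (Cod C \<pi>)" using homsD[OF ej] \<pi>' by simp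
    fix W t assume t: "t \<in> homs C (Cod C (e \<cdot> j)) W" "t \<cdot> e \<cdot> j = Zero C (Dom C (e \<cdot> j)) W"
    note t' = homsD[OF t(1), unfolded homsD(3)[OF ej]]
    have te: "t \<cdot> e \<in> Ar C" "Dom C (t \<cdot> e) = S" "Cod C (t \<cdot> e) = W" using t' e' E by simp_all
    have tej: "(t \<cdot> e) \<cdot> j = Zero C Q W" using t(2) t' e' E ar homsD[OF ej] by simp
    have "((t \<cdot> e) \<cdot> i) \<cdot> f \<oplus> ((t \<cdot> e) \<cdot> j) \<cdot> g = (t \<cdot> e) \<cdot> h"
      using te t' e' E ar f' g' by (simp add: h_def)
    also have "\<dots> = Zero C M W" using t' e' E h by simp
    finally have "((t \<cdot> e) \<cdot> i) \<cdot> f = Zero C M W"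
      unfolding tej using te t' e' E ar f' g' by simp
    then obtain v where v: "v \<in> homs C (Cod C c) W" "v \<cdot> c = (t \<cdot> e) \<cdot> i"
      using cokernel_factor[OF c, of "(t \<cdot> e) \<cdot> i" W] te ar f' by (auto simp: homs_def)
    note v' = homsD[OF v(1)]
    have "t \<cdot> e \<in> homs C S W" using te by (simp add: homs_def)
    then have "t \<cdot> e = ((t \<cdot> e) \<cdot> i) \<cdot> p \<oplus> ((t \<cdot> e) \<cdot> j) \<cdot> q"
      using biproduct_decompose(1)[OF b] by simp
    also have "\<dots> = ((t \<cdot> e) \<cdot> i) \<cdot> p"
      unfolding tej using te t' e' E ar by simp
    also have "\<dots> = v \<cdot> c \<cdot> p"
      unfolding v(2)[symmetric] by (rule comp_assoc) (use v' c' f' ar in simp_all)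
    also have "\<dots> = (v \<cdot> \<pi>) \<cdot> e" using v' \<pi> \<pi>' e' E by simp
    finally have "t \<cdot> e = (v \<cdot> \<pi>) \<cdot> e" .
    then have "t = v \<cdot> \<pi>"
      by (rule epic_cancel[OF cokernel_epic[OF e]]) (use v' \<pi>' t' e' E in simp_all)
    then show "\<exists>u\<in>homs C (Cod C \<pi>) W. u \<cdot> \<pi> = t" using v(1) \<pi>' by auto
  qed
  from split_direct_sum[OF ej r(1) rej this] show ?thesis using \<pi>' E by simp
qed

lemma cokernel_uminus:
  assumes c: "is_cokernel C c g" and g: "g \<in> homs C X Y" "g' \<in> homs C X Y" "g \<oplus> g' = Zero C X Y"
  shows "is_cokernel C c g'"
proof -
  note g0 = homsD[OF g(1)] and g1 = homsD[OF g(2)] and c' = cokernelD[OF c]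
  have sum: "h \<cdot> g \<oplus> h \<cdot> g' = Zero C X (Cod C h)" if "h \<in> Ar C" "Dom C h = Y" for h
  proof -
    have "h \<cdot> (g \<oplus> g') = Zero C X (Cod C h)"
      unfolding g(3) using that g0 cod_in_Ob by simp
    then show ?thesis using that g0 g1 by simp
  qed
  show ?thesis
  proof (rule is_cokernelI[OF cokernel_epic[OF c]])
    show "c \<cdot> g' = Zero C (Dom C g') (Cod C c)"
      using sum[of c] c' g0 g1 by simp
    fix W h assume h: "h \<in> homs C (Cod C g') W" "h \<cdot> g' = Zero C (Dom C g') W"
    note h' = homsD[OF h(1), unfolded g1]
    have "h \<cdot> g = Zero C X W" using sum[of h] h(2) h' g0 g1 by simp
    then show "\<exists>u\<in>homs C (Cod C c) W. u \<cdot> c = h"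
      using cokernel_factor[OF c, of h W] h(1) g0 g1 by metis
  qed (use c' g0 g1 in simp_all)
qed

text \<open>The cokernel of (f, -g) from \<open>M\<close> to the direct sum of \<open>P\<close> and
  \<open>Q\<close> is the direct sum of \<open>Cod C c\<close> and \<open>Q\<close>, and also that
  of \<open>Cod C d\<close> and \<open>P\<close>. Torsionfreeness moves from \<open>Cod C c\<close>
  up to this common object and down again to \<open>Cod C d\<close>.\<close>

lemma torsionfree_rec_cokernel_unique:
  assumes f: "approx_embedding C f" and c: "is_cokernel C c f"
    and K: "Cod C c \<in> torsionfree_rec C n"
    and g: "approx_embedding C g" and d: "is_cokernel C d g" and fg: "Dom C f = Dom C g"
  shows "Cod C d \<in> torsionfree_rec C n"
proof -
  define M P Q where "M = Dom C f" and "P = Cod C f" and "Q = Cod C g"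
  note c' = cokernelD[OF c] and d' = cokernelD[OF d]
  have f': "f \<in> homs C M P" and g': "g \<in> homs C M Q"
    using c' d' fg by (auto simp: M_def P_def Q_def homs_def)
  have lpa: "left_projective_approximation C f" "left_projective_approximation C g"
    using f g by (auto simp: approx_embedding_def)
  have PQ: "P \<in> projectives C" "Q \<in> projectives C"
    using lpa by (auto simp: left_projective_approximation_def P_def Q_def)
  obtain S i j p q where b: "is_biproduct C P Q S i j p q"
    using has_direct_sums[of P Q] PQ unfolding projectives_def is_direct_sum_def by blast
  \<comment> \<open>\<open>g1\<close> is the negative of \<open>g\<close>, so that both
    \<open>u \<cdot> f \<oplus> g1\<close> and \<open>v \<cdot> g1 \<oplus> f\<close>
    vanish.\<close>
  obtain g1 where g1: "g1 \<in> homs C M Q" "g \<oplus> g1 = Zero C M Q" using plus_inverse[OF g'] .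
  obtain u where u: "u \<in> homs C P Q" "u \<cdot> f = g"
    using approximation_factor[OF lpa(1) PQ(2)] g' M_def P_def by metis
  obtain v where v: "v \<in> homs C Q P" "v \<cdot> g = f"
    using approximation_factor[OF lpa(2) PQ(1)] f' fg M_def Q_def by metis
  note ar = biproductD(1-4)[OF b, THEN homsD(1)] biproductD(1-4)[OF b, THEN homsD(2)]
    biproductD(1-4)[OF b, THEN homsD(3)]
  note f1 = homsD[OF f'] and g0' = homsD[OF g'] and g1' = homsD[OF g1(1)] and v' = homsD[OF v(1)]
  have "i \<cdot> f \<oplus> j \<cdot> g1 \<in> Ar C" using ar f1 g1' by simp
  then obtain e where e: "is_cokernel C e (i \<cdot> f \<oplus> j \<cdot> g1)" using has_cokernels by blast
  have "is_direct_sum C (Cod C c) Q (Cod C e)"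
    by (rule cokernel_pair_direct_sum[OF c f' g1(1) u(1) _ b e]) (use u(2) g1(2) in simp)
  then have E: "Cod C e \<in> torsionfree_rec C n"
    by (rule torsionfree_rec_plus_projective[OF K PQ(2)])
  have "v \<cdot> (g \<oplus> g1) = Zero C M P" unfolding g1(2) using v' f1 by simp
  then have "f \<oplus> v \<cdot> g1 = Zero C M P" using v(2) v' g0' g1' by simp
  then have vg: "v \<cdot> g1 \<oplus> f = Zero C M P" using plus_comm[of f "v \<cdot> g1"] v' g1' f1 by simp
  have "i \<cdot> f \<oplus> j \<cdot> g1 = j \<cdot> g1 \<oplus> i \<cdot> f" by (rule plus_comm) (use ar f1 g1' in simp_all)
  then have e': "is_cokernel C e (j \<cdot> g1 \<oplus> i \<cdot> f)" using e by simp
  \<comment> \<open>The same computation with \<open>f\<close> and \<open>g1\<close>, and the two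
    summands, interchanged; \<open>d\<close> is also a cokernel of \<open>g1\<close>, as a sign does
    not affect cokernels.\<close>
  have "is_direct_sum C (Cod C d) P (Cod C e)"
    by (rule cokernel_pair_direct_sum[OF cokernel_uminus[OF d g' g1] g1(1) f' v(1) vg
          biproduct_sym[OF b] e'])
  then show ?thesis by (rule torsionfree_rec_minus_projective[OF E PQ(1)])
qed

end

section \<open>Exact adjunctions\<close>

lemma functor_homs:
  assumes "is_functor C D F" "f \<in> homs C X Y"
  shows "ArMap F f \<in> homs D (ObMap F X) (ObMap F Y)"
  using assms unfolding is_functor_def by blast

lemma exact_functor_is_functor: "exact_functor C D F \<Longrightarrow> is_functor C D F"
  by (simp add: exact_functor_def additive_functor_def)

section \<open>Exact functors on monics, epics and cokernels\<close>

context
  fixes C :: "('o1, 'm1, 'y) acat_scheme" and D :: "('o2, 'm2, 'z) acat_scheme"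
    and F :: "('o1, 'm1, 'o2, 'm2) fctr"
  assumes C: "abelian_category C" and D: "abelian_category D" and F: "exact_functor C D F"
begin

interpretation C: abelian_category C by (rule C)
interpretation D: abelian_category D by (rule D)

lemma exact_functor_monic_cokernel:
  assumes "monic C f" "is_cokernel C c f"
  shows "monic D (ArMap F f)" "is_cokernel D (ArMap F c) (ArMap F f)"
  using F assms C.short_exact_iff[of f c] D.short_exact_iff[of "ArMap F f" "ArMap F c"]
  by (auto simp: exact_functor_def)

lemma exact_functor_monic:
  assumes "monic C f"
  shows "monic D (ArMap F f)"
proof -
  obtain c where "is_cokernel C c f" using C.has_cokernels assms unfolding monic_def by blast
  then show ?thesis using exact_functor_monic_cokernel(1)[OF assms] by blast
qed

text \<open>An epic is the cokernel of its kernel, so it ends a short exact sequence and is still a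
  cokernel after applying \<open>F\<close>.\<close>

lemma exact_functor_epic:
  assumes "epic C e"
  shows "epic D (ArMap F e)"
proof -
  obtain k where k: "is_kernel C k e" using C.has_kernels assms unfolding epic_def by blast
  have "is_cokernel D (ArMap F e) (ArMap F k)"
    by (rule exact_functor_monic_cokernel(2)[OF C.kernel_monic[OF k]
          C.epic_is_cokernel_of_kernel[OF assms k]])
  then show ?thesis by (rule D.cokernel_epic)
qed

end

text \<open>The predicate \<open>left_adjoint\<close> only asserts that natural bijections exist;
  fixing one family \<open>\<phi>\<close> allows all arguments to run by transposing arrows, without
  unit and counit.\<close>

locale exact_adjunction = A: abelian_category A + B: abelian_category B
  for A :: "('oa, 'ma, 'y) acat_scheme" and B :: "('ob, 'mb, 'z) acat_scheme" +
  fixes F :: "('oa, 'ma, 'ob, 'mb) fctr" and G :: "('ob, 'mb, 'oa, 'ma) fctr"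
    and \<phi> :: "'oa \<Rightarrow> 'ob \<Rightarrow> 'mb \<Rightarrow> 'ma"
  assumes F: "exact_functor A B F" and G: "exact_functor B A G"
    and G_proj: "preserves_projectives B A G"
    and transpose_bij: "X \<in> Ob A \<Longrightarrow> Y \<in> Ob B \<Longrightarrow>
      bij_betw (\<phi> X Y) (homs B (ObMap F X) Y) (homs A X (ObMap G Y))"
    and transpose_natural: "a \<in> homs A X' X \<Longrightarrow> b \<in> homs B Y Y' \<Longrightarrow> h \<in> homs B (ObMap F X) Y \<Longrightarrow>
      \<phi> X' Y' (Cmp B b (Cmp B h (ArMap F a))) = Cmp A (ArMap G b) (Cmp A (\<phi> X Y h) a)"
begin

lemma F_functor: "is_functor A B F" and G_functor: "is_functor B A G"
  using F G exact_functor_is_functor by blast+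

lemmas F_homs = functor_homs[OF F_functor]
lemmas G_homs = functor_homs[OF G_functor]

lemma F_Ob: "X \<in> Ob A \<Longrightarrow> ObMap F X \<in> Ob B"
  using F_functor by (simp add: is_functor_def)

lemma F_dom_cod:
  assumes "f \<in> Ar A"
  shows "ArMap F f \<in> Ar B" "Dom B (ArMap F f) = ObMap F (Dom A f)"
    "Cod B (ArMap F f) = ObMap F (Cod A f)"
  using B.homsD[OF F_homs[OF A.Ar_homs[OF assms]]] by simp_all

lemma transpose_homs:
  assumes "X \<in> Ob A" "h \<in> homs B (ObMap F X) Y"
  shows "\<phi> X Y h \<in> homs A X (ObMap G Y)"
  using transpose_bij[OF assms(1) B.homsD(5)[OF assms(2)]] assms(2) by (rule bij_betw_apply)

lemma transpose_surj:
  assumes "Y \<in> Ob B" "k \<in> homs A X (ObMap G Y)"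
  obtains h where "h \<in> homs B (ObMap F X) Y" "\<phi> X Y h = k"
  using transpose_bij[OF A.homsD(4)[OF assms(2)] assms(1)] assms(2)
  by (metis bij_betw_imp_surj_on imageE)

lemma transpose_inj:
  assumes "X \<in> Ob A" "h \<in> homs B (ObMap F X) Y" "k \<in> homs B (ObMap F X) Y" "\<phi> X Y h = \<phi> X Y k"
  shows "h = k"
  using transpose_bij[OF assms(1) B.homsD(5)[OF assms(2)]] assms(2-)
  by (metis bij_betw_imp_inj_on inj_onD)

text \<open>Naturality is assumed in both variables at once; an identity in the second slot isolates
  the first. \<open>transpose_post\<close> does the reverse.\<close>

lemma transpose_pre:
  assumes a: "a \<in> homs A X' X" and h: "h \<in> homs B (ObMap F X) Y"
  shows "\<phi> X' Y (Cmp B h (ArMap F a)) = Cmp A (\<phi> X Y h) a"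
proof -
  note a' = A.homsD[OF a] and h' = B.homsD[OF h] and k' = A.homsD[OF transpose_homs[OF _ h]]
  have "\<phi> X' Y (Cmp B (Idt B Y) (Cmp B h (ArMap F a))) =
      Cmp A (ArMap G (Idt B Y)) (Cmp A (\<phi> X Y h) a)"
    by (rule transpose_natural[OF a B.id_in_homs[OF h'(5)] h])
  moreover have "ArMap G (Idt B Y) = Idt A (ObMap G Y)"
    using G_functor h'(5) by (simp add: is_functor_def)
  ultimately show ?thesis
    using a' h' B.homsD[OF F_homs[OF a]] k' by simp
qed

lemma transpose_post:
  assumes X: "X \<in> Ob A" and h: "h \<in> homs B (ObMap F X) Y" and b: "b \<in> homs B Y Y'"
  shows "\<phi> X Y' (Cmp B b h) = Cmp A (ArMap G b) (\<phi> X Y h)"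
proof -
  have "\<phi> X Y' (Cmp B b (Cmp B h (ArMap F (Idt A X)))) =
      Cmp A (ArMap G b) (Cmp A (\<phi> X Y h) (Idt A X))"
    by (rule transpose_natural[OF A.id_in_homs[OF X] b h])
  moreover have "ArMap F (Idt A X) = Idt B (ObMap F X)"
    using F_functor X by (simp add: is_functor_def)
  ultimately show ?thesis
    using B.homsD[OF h] A.homsD[OF transpose_homs[OF X h]] by simp
qed

text \<open>Lifting an arrow from \<open>F P\<close> along an epic \<open>e\<close> transposes to
  lifting an arrow from \<open>P\<close> along \<open>G e\<close>, which is epic because
  \<open>G\<close> is exact.\<close>

lemma F_projective:
  assumes P: "P \<in> projectives A"
  shows "ObMap F P \<in> projectives B"
proof -
  have PO: "P \<in> Ob A" using P by (simp add: projectives_def)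
  have "\<exists>g\<in>homs B (ObMap F P) (Dom B e). Cmp B e g = f"
    if e: "epic B e" and f: "f \<in> homs B (ObMap F P) (Cod B e)" for e f
  proof -
    have e': "e \<in> homs B (Dom B e) (Cod B e)" using e B.Ar_homs by (simp add: epic_def)
    note Ge = A.homsD[OF G_homs[OF e']]
    obtain k where k: "k \<in> homs A P (ObMap G (Dom B e))" "Cmp A (ArMap G e) k = \<phi> P (Cod B e) f"
      using projective_lift[OF P exact_functor_epic[OF B.abelian_category_axioms
            A.abelian_category_axioms G e], of "\<phi> P (Cod B e) f"] transpose_homs[OF PO f] Ge
      by metis
    obtain h where h: "h \<in> homs B (ObMap F P) (Dom B e)" "\<phi> P (Dom B e) h = k"
      by (rule transpose_surj[OF B.homsD(4)[OF e'] k(1)])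
    have "Cmp B e h = f"
      by (rule transpose_inj[OF PO B.cmp_in_homs[OF h(1) e'] f])
        (simp add: transpose_post[OF PO h(1) e'] h k)
    then show ?thesis using h(1) by blast
  qed
  then show ?thesis using F_Ob[OF PO] by (simp add: projectives_def)
qed

text \<open>Extending an arrow with projective target \<open>Q\<close> along \<open>F f\<close>
  transposes to extending one with target \<open>G Q\<close> along \<open>f\<close>, and
  \<open>G Q\<close> is projective. Monicity is exactness of \<open>F\<close>.\<close>

lemma F_approx_embedding:
  assumes f: "approx_embedding A f"
  shows "approx_embedding B (ArMap F f)"
proof -
  have lpa: "left_projective_approximation A f" and mono: "monic A f"
    using f by (auto simp: approx_embedding_def)
  have ar: "f \<in> Ar A" using mono by (simp add: monic_def)
  note f' = A.Ar_homs[OF ar]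
  have X: "Dom A f \<in> Ob A" by (rule A.dom_in_Ob[OF ar])
  have "\<exists>u\<in>homs B (ObMap F (Cod A f)) Q. Cmp B u (ArMap F f) = h"
    if Q: "Q \<in> projectives B" and h: "h \<in> homs B (ObMap F (Dom A f)) Q" for Q h
  proof -
    have QO: "Q \<in> Ob B" using Q by (simp add: projectives_def)
    have GQ: "ObMap G Q \<in> projectives A" using Q G_proj by (simp add: preserves_projectives_def)
    obtain k where k: "k \<in> homs A (Cod A f) (ObMap G Q)" "Cmp A k f = \<phi> (Dom A f) Q h"
      by (rule approximation_factor[OF lpa GQ transpose_homs[OF X h]])
    obtain u where u: "u \<in> homs B (ObMap F (Cod A f)) Q" "\<phi> (Cod A f) Q u = k"
      by (rule transpose_surj[OF QO k(1)])
    have "Cmp B u (ArMap F f) = h"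
      by (rule transpose_inj[OF X B.cmp_in_homs[OF F_homs[OF f'] u(1)] h])
        (simp add: transpose_pre[OF f' u(1)] u k)
    then show ?thesis using u(1) by blast
  qed
  moreover have "ObMap F (Cod A f) \<in> projectives B"
    using F_projective lpa by (simp add: left_projective_approximation_def)
  moreover have "monic B (ArMap F f)"
    by (rule exact_functor_monic[OF A.abelian_category_axioms B.abelian_category_axioms F mono])
  ultimately show ?thesis
    using F_dom_cod[OF ar] by (simp add: approx_embedding_def left_projective_approximation_def)
qed

lemma F_cokernel:
  assumes "approx_embedding A f" "is_cokernel A c f"
  shows "is_cokernel B (ArMap F c) (ArMap F f)"
  using assms exact_functor_monic_cokernel(2)[OF A.abelian_category_axioms
      B.abelian_category_axioms F]
  by (simp add: approx_embedding_def)

lemma F_torsionfree_rec: "X \<in> torsionfree_rec A n \<Longrightarrow> ObMap F X \<in> torsionfree_rec B n"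
proof (induction n arbitrary: X)
  case 0
  then show ?case by (simp add: F_Ob)
next
  case (Suc n)
  then obtain f c where f: "approx_embedding A f" "Dom A f = X" and c: "is_cokernel A c f"
    and L: "Cod A c \<in> torsionfree_rec A n" by auto
  note c' = A.cokernelD[OF c]
  have "Cod B (ArMap F c) \<in> torsionfree_rec B n"
    using Suc.IH[OF L] F_dom_cod[OF c'(1)] by simp
  then show ?case
    using F_approx_embedding[OF f(1)] F_cokernel[OF f(1) c] F_dom_cod[OF c'(2)] f(2) by auto
qed

text \<open>The targets to which every arrow from \<open>X\<close> extends along \<open>f\<close>
  are closed under zero objects, direct sums and summands. The approximation property can therefore
  be tested on generators of the projectives.\<close>

lemma factor_through_add_closure:
  assumes f: "f \<in> homs A X Y"
    and base: "\<And>W h. W \<in> S \<Longrightarrow> h \<in> homs A X W \<Longrightarrow> \<exists>u\<in>homs A Y W. Cmp A u f = h"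
    and W: "W \<in> add_closure A S" and h: "h \<in> homs A X W"
  shows "\<exists>u\<in>homs A Y W. Cmp A u f = h"
  using W h
proof (induction arbitrary: h)
  case (base W)
  then show ?case using assms(2) by blast
next
  case (zero Z)
  note f' = A.homsD[OF f] and h' = A.homsD[OF zero(2)]
  have "h = Zero A X Z" by (rule A.zero_object_unique(2)[OF zero])
  then show ?case
    using f' h' by (intro bexI[of _ "Zero A Y Z"]) (simp_all add: homs_def)
next
  case (sum W1 W2 W)
  obtain i j p q where b: "is_biproduct A W1 W2 W i j p q"
    using sum.hyps unfolding is_direct_sum_def by blast
  note ar = A.biproductD(1-4)[OF b, THEN A.homsD(1)] A.biproductD(1-4)[OF b, THEN A.homsD(2)]
    A.biproductD(1-4)[OF b, THEN A.homsD(3)]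
  note f' = A.homsD[OF f] and h' = A.homsD[OF sum.prems]
  obtain u1 where u1: "u1 \<in> homs A Y W1" "Cmp A u1 f = Cmp A p h"
    using sum.IH(1)[of "Cmp A p h"] ar h' by (auto simp: homs_def)
  obtain u2 where u2: "u2 \<in> homs A Y W2" "Cmp A u2 f = Cmp A q h"
    using sum.IH(2)[of "Cmp A q h"] ar h' by (auto simp: homs_def)
  note u' = A.homsD[OF u1(1)] A.homsD[OF u2(1)]
  let ?u = "Add A (Cmp A i u1) (Cmp A j u2)"
  have "Cmp A ?u f = Add A (Cmp A i (Cmp A p h)) (Cmp A j (Cmp A q h))"
    using u1(2) u2(2) u' f' ar by simp
  also have "\<dots> = h" by (rule A.biproduct_decompose(2)[OF b sum.prems])
  finally show ?case using u' ar by (intro bexI[of _ ?u]) (simp_all add: homs_def)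
next
  case (summand W X1 X2)
  obtain i j p q where b: "is_biproduct A X1 X2 W i j p q"
    using summand.hyps unfolding is_direct_sum_def by blast
  note bi = A.biproductD[OF b]
  note ar = bi(1,3)[THEN A.homsD(1)] bi(1,3)[THEN A.homsD(2)] bi(1,3)[THEN A.homsD(3)]
  note f' = A.homsD[OF f] and h' = A.homsD[OF summand.prems]
  \<comment> \<open>Enlarge the target by \<open>i\<close>, extend there, and return along
    \<open>p\<close>; this recovers \<open>h\<close> because \<open>p\<close> after \<open>i\<close>
    is the identity.\<close>
  obtain u where u: "u \<in> homs A Y W" "Cmp A u f = Cmp A i h"
    using summand.IH[of "Cmp A i h"] ar h' by (auto simp: homs_def)
  note u' = A.homsD[OF u(1)]
  have "Cmp A (Cmp A p u) f = h"
    using A.comp_reassoc[OF bi(5), of h] u(2) u' f' ar h' by simp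
  then show ?case using u' ar by (intro bexI[of _ "Cmp A p u"]) (simp_all add: homs_def)
qed

text \<open>If the transpose identifies \<open>a\<close> and \<open>b\<close>, then \<open>g\<close>
  identifies \<open>F a\<close> and \<open>F b\<close>, and monicity of \<open>g\<close> with
  faithfulness of \<open>F\<close> gives \<open>a = b\<close>. For a target \<open>G R\<close> the
  extension is \<open>G u\<close>, where \<open>u\<close> extends the transposed arrow along
  \<open>g\<close>; the other projectives are reached through the additive closure.\<close>

lemma transpose_approx_embedding:
  assumes faithful: "faithful_functor A B F"
    and gen: "projectives A = add_closure A (ObMap G ` projectives B)"
    and X: "X \<in> Ob A" and g: "approx_embedding B g" "Dom B g = ObMap F X"
  shows "approx_embedding A (\<phi> X (Cod B g) g)"
proof -
  define Q where "Q = Cod B g"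
  have lpa: "left_projective_approximation B g" and mono: "monic B g"
    using g by (auto simp: approx_embedding_def)
  have Q: "Q \<in> projectives B" using lpa by (simp add: left_projective_approximation_def Q_def)
  have gh: "g \<in> homs B (ObMap F X) Q" using mono g(2) by (simp add: monic_def homs_def Q_def)
  define f where "f = \<phi> X Q g"
  have f: "f \<in> homs A X (ObMap G Q)" unfolding f_def by (rule transpose_homs[OF X gh])
  note f' = A.homsD[OF f]
  have "a = b" if a: "a \<in> homs A W X" and b: "b \<in> homs A W X" and eq: "Cmp A f a = Cmp A f b" for W a b
  proof -
    have W: "W \<in> Ob A" using A.homsD[OF a] by blast
    note Fa = F_homs[OF a] and Fb = F_homs[OF b]
    have "Cmp B g (ArMap F a) = Cmp B g (ArMap F b)"
      by (rule transpose_inj[OF W B.cmp_in_homs[OF Fa gh] B.cmp_in_homs[OF Fb gh]])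
        (use transpose_pre[OF a gh] transpose_pre[OF b gh] eq in \<open>simp add: f_def\<close>)
    then have "ArMap F a = ArMap F b"
      by (rule B.monic_cancel[OF mono])
        (use B.homsD[OF Fa] B.homsD[OF Fb] B.homsD[OF gh] in simp_all)
    then show ?thesis
      using faithful a b W X unfolding faithful_functor_def by (meson inj_onD)
  qed
  then have "monic A f" using f' by (simp add: monic_def)
  moreover have "\<exists>u\<in>homs A (ObMap G Q) P. Cmp A u f = h"
    if P: "P \<in> projectives A" and h: "h \<in> homs A X P" for P h
  proof (rule factor_through_add_closure[OF f _ _ h])
    show "P \<in> add_closure A (ObMap G ` projectives B)" using P gen by simp
    fix W k assume "W \<in> ObMap G ` projectives B" and k: "k \<in> homs A X W"
    then obtain R where R: "R \<in> projectives B" "W = ObMap G R" by blast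
    have RO: "R \<in> Ob B" using R by (simp add: projectives_def)
    obtain k' where k': "k' \<in> homs B (ObMap F X) R" "\<phi> X R k' = k"
      using transpose_surj[OF RO] k R(2) by metis
    obtain u where u: "u \<in> homs B Q R" "Cmp B u g = k'"
      using approximation_factor[OF lpa R(1), of k'] k'(1) g(2) Q_def by metis
    have "Cmp A (ArMap G u) f = k"
      unfolding f_def using transpose_post[OF X gh u(1)] u(2) k'(2) by simp
    then show "\<exists>u\<in>homs A (ObMap G Q) W. Cmp A u f = k"
      using G_homs[OF u(1)] R(2) by blast
  qed
  moreover have "ObMap G Q \<in> projectives A"
    using Q G_proj by (simp add: preserves_projectives_def)
  ultimately show ?thesis
    using f' unfolding approx_embedding_def left_projective_approximation_def
    by (simp add: f_def Q_def)
qed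

lemma F_reflects_torsionfree_rec:
  assumes "faithful_functor A B F" "projectives A = add_closure A (ObMap G ` projectives B)"
  shows "X \<in> Ob A \<Longrightarrow> ObMap F X \<in> torsionfree_rec B n \<Longrightarrow> X \<in> torsionfree_rec A n"
proof (induction n arbitrary: X)
  case 0
  then show ?case by simp
next
  case (Suc n)
  obtain g d where g: "approx_embedding B g" "Dom B g = ObMap F X" and d: "is_cokernel B d g"
    and L: "Cod B d \<in> torsionfree_rec B n" using Suc.prems(2) by auto
  define f where "f = \<phi> X (Cod B g) g"
  have gh: "g \<in> homs B (ObMap F X) (Cod B g)" using B.cokernelD[OF d] g(2) by (simp add: homs_def)
  note f' = A.homsD[OF transpose_homs[OF Suc.prems(1) gh], folded f_def]
  have f: "approx_embedding A f"
    unfolding f_def by (rule transpose_approx_embedding[OF assms Suc.prems(1) g])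
  obtain c where c: "is_cokernel A c f" using A.has_cokernels f' by blast
  note c' = A.cokernelD[OF c]
  \<comment> \<open>The hypothesis speaks about the cokernel of \<open>g\<close>, whereas induction
    needs the cokernel of \<open>F f\<close>, which is \<open>F\<close> applied to \<open>c\<close>.
    Both \<open>g\<close> and \<open>F f\<close> are monic approximations of \<open>F X\<close>, so
    the comparison of cokernels bridges the gap.\<close>
  have "Cod B (ArMap F c) \<in> torsionfree_rec B n"
    by (rule B.torsionfree_rec_cokernel_unique[OF g(1) d L F_approx_embedding[OF f]
          F_cokernel[OF f c]]) (use F_dom_cod[OF f'(1)] f' g(2) in simp)
  then have "Cod A c \<in> torsionfree_rec A n"
    using Suc.IH[OF c'(7)] F_dom_cod[OF c'(1)] by simp
  then show ?case using f c f' by auto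
qed

end

theorem theoremA:
  fixes A :: "('oa, 'ma) acat"
    and B :: "('ob, 'mb) acat"
    and F :: "('oa, 'ma, 'ob, 'mb) fctr"
    and G :: "('ob, 'mb, 'oa, 'ma) fctr"
  assumes "abelian_category A" and "enough_projectives A"
    and "abelian_category B" and "enough_projectives B"
    and "additive_functor A B F" and "additive_functor B A G"
    and "left_adjoint A B F G"
    and "exact_functor A B F" and "exact_functor B A G"
    and "preserves_projectives B A G"
  shows "(\<forall>n\<ge>1. \<forall>X. X \<in> torsionfree A n \<longrightarrow> ObMap F X \<in> torsionfree B n) \<and>
    (faithful_functor A B F \<and> projectives A = add_closure A (ObMap G ` projectives B) \<longrightarrow>
      (\<forall>n\<ge>1. \<forall>X\<in>Ob A. X \<in> torsionfree A n \<longleftrightarrow> ObMap F X \<in> torsionfree B n))"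
proof -
  obtain \<phi> :: "'oa \<Rightarrow> 'ob \<Rightarrow> 'mb \<Rightarrow> 'ma" where
    bij: "\<forall>X\<in>Ob A. \<forall>Y\<in>Ob B.
      bij_betw (\<phi> X Y) (homs B (ObMap F X) Y) (homs A X (ObMap G Y))" and
    nat: "\<forall>X\<in>Ob A. \<forall>X'\<in>Ob A. \<forall>Y\<in>Ob B. \<forall>Y'\<in>Ob B.
      \<forall>a\<in>homs A X' X. \<forall>b\<in>homs B Y Y'. \<forall>h\<in>homs B (ObMap F X) Y.
        \<phi> X' Y' (Cmp B b (Cmp B h (ArMap F a))) = Cmp A (ArMap G b) (Cmp A (\<phi> X Y h) a)"
    using assms(7) unfolding left_adjoint_def by (elim conjE exE) (rule that)
  interpret A: abelian_category A by (rule assms(1))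
  interpret B: abelian_category B by (rule assms(3))
  interpret exact_adjunction A B F G \<phi>
  proof
    fix X X' Y Y' a b h
    assume a: "a \<in> homs A X' X" and b: "b \<in> homs B Y Y'" and h: "h \<in> homs B (ObMap F X) Y"
    show "\<phi> X' Y' (Cmp B b (Cmp B h (ArMap F a))) = Cmp A (ArMap G b) (Cmp A (\<phi> X Y h) a)"
      using nat A.homsD(4,5)[OF a] B.homsD(4,5)[OF b] a b h by blast
  qed (use assms(8-10) bij in simp_all)
  have "ObMap F X \<in> torsionfree B n" if "n \<ge> 1" "X \<in> torsionfree A n" for n X
    using F_torsionfree_rec[of X n] that by (simp add: A.torsionfree_eq_rec B.torsionfree_eq_rec)
  moreover have "X \<in> torsionfree A n"
    if "faithful_functor A B F" "projectives A = add_closure A (ObMap G ` projectives B)"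
      "n \<ge> 1" "X \<in> Ob A" "ObMap F X \<in> torsionfree B n" for n X
    using F_reflects_torsionfree_rec[OF that(1,2,4)] that(3,5)
    by (simp add: A.torsionfree_eq_rec B.torsionfree_eq_rec)
  ultimately show ?thesis by blast
qed

end
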